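(* Let $G$ be a simple graph on $n \geq 2$ vertices and let $\bar{G}$ be its complement. Then $$\lambda(G) + \lambda(\bar{G}) \geq 1,$$ with equality if and only if $G$ or $\bar{G}$ is isomorphic to the join of a single (isolated) vertex and a disconnected graph of order $n-1$.
   Context: For a simple graph $G$ on $n$ vertices, $L(G) = D(G) - A(G)$ is its Laplacian matrix, where $A(G)$ is the adjacency matrix and $D(G)$ the diagonal matrix of vertex degrees. Its eigenvalues are $0 = \lambda_1(G) \leq \lambda_2(G) \leq \cdots \leq \lambda_n(G)$, and $\lambda(G) := \lambda_2(G)$ is the algebraic connectivity. The join of two graphs is their disjoint union together with all edges between a vertex of the first and a vertex of the second. *)

theory Defs
  imports "Jordan_Normal_Form.Char_Poly"
begin

type_synonym 'v graph = "'v set \<times> ('v \<Rightarrow> 'v \<Rightarrow> bool)"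

definition simple_graph :: "'v graph \<Rightarrow> bool" where
  "simple_graph G \<longleftrightarrow> finite (fst G) \<and>
     (\<forall>x\<in>fst G. \<forall>y\<in>fst G. snd G x y \<longleftrightarrow> snd G y x) \<and>
     (\<forall>x\<in>fst G. \<not> snd G x x)"

definition connected_graph :: "'v graph \<Rightarrow> bool" where
  "connected_graph G \<longleftrightarrow> fst G \<noteq> {} \<and>
     (\<forall>x\<in>fst G. \<forall>y\<in>fst G.
        (\<lambda>a b. a \<in> fst G \<and> b \<in> fst G \<and> snd G a b)\<^sup>*\<^sup>* x y)"

definition graph_iso :: "'v graph \<Rightarrow> 'w graph \<Rightarrow> bool" where
  "graph_iso G H \<longleftrightarrow> (\<exists>f. bij_betw f (fst G) (fst H) \<and>
     (\<forall>x\<in>fst G. \<forall>y\<in>fst G. snd G x y \<longleftrightarrow> snd H (f x) (f y)))"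

definition graph_join :: "'v graph \<Rightarrow> 'w graph \<Rightarrow> ('v + 'w) graph" where
  "graph_join G H = (Inl ` fst G \<union> Inr ` fst H,
     (\<lambda>a b. case (a, b) of
        (Inl x, Inl y) \<Rightarrow> snd G x y
      | (Inr x, Inr y) \<Rightarrow> snd H x y
      | _ \<Rightarrow> True))"

definition K1 :: "unit graph" where
  "K1 = ({()}, (\<lambda>_ _. False))"

definition complement :: "nat \<Rightarrow> (nat \<Rightarrow> nat \<Rightarrow> bool) \<Rightarrow> (nat \<Rightarrow> nat \<Rightarrow> bool)" where
  "complement n E = (\<lambda>i j. i < n \<and> j < n \<and> i \<noteq> j \<and> \<not> E i j)"

definition degree :: "nat \<Rightarrow> (nat \<Rightarrow> nat \<Rightarrow> bool) \<Rightarrow> nat \<Rightarrow> nat" where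
  "degree n E i = card {k. k < n \<and> E i k}"

definition laplacian :: "nat \<Rightarrow> (nat \<Rightarrow> nat \<Rightarrow> bool) \<Rightarrow> real mat" where
  "laplacian n E = mat n n (\<lambda>(i, j).
     (if i = j then real (degree n E i) else 0) - (if E i j then 1 else 0))"

text \<open>The eigenvalues (with algebraic multiplicity) in nondecreasing order:
  the sorted list whose linear factors make up the characteristic polynomial.
  For a real symmetric matrix this list exists and is unique.\<close>
definition sorted_eigenvalues :: "real mat \<Rightarrow> real list" where
  "sorted_eigenvalues A = (THE xs. sorted xs \<and>
     char_poly A = (\<Prod>x\<leftarrow>xs. [:- x, 1:]))"

definition alg_conn :: "nat \<Rightarrow> (nat \<Rightarrow> nat \<Rightarrow> bool) \<Rightarrow> real" where
  "alg_conn n E = sorted_eigenvalues (laplacian n E) ! 1"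

end

theory Submission
  imports Defs "Jordan_Normal_Form.Spectral_Radius"
begin

text \<open>
  Write \<open>a\<close> and \<open>b\<close> for the algebraic connectivities of \<open>E\<close> and its complement \<open>F\<close>.  Since the two
  Laplacians add up to \<open>n I - J\<close>, there are orthonormal eigenfunctions \<open>x\<close> of \<open>E\<close> and \<open>y\<close> of \<open>F\<close>,
  both of mean zero, with energies \<open>a\<close> and \<open>b\<close>.  The heart is that \<open>a < 1\<close>, \<open>b < 1\<close> and
  \<open>a + b \<le> 1\<close> are incompatible.

  If \<open>a < 1\<close>, the maximum principle shows that vertices \<open>u\<close>, \<open>v\<close> where \<open>x\<close> is maximal and minimal
  are not adjacent and have no common neighbour in \<open>E\<close>; the same holds for the extremal vertices
  \<open>c\<close>, \<open>d\<close> of \<open>y\<close> in \<open>F\<close>.  Hence, up to signs, \<open>u - c - d - v\<close> is an induced path of \<open>E\<close>.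
  Let \<open>X\<close> and \<open>Y\<close> be the squared oscillations of \<open>x\<close> and \<open>y\<close>.  Orthonormality gives
  \<open>\<Sum> (x i - x j)\<^sup>2 (y i - y j)\<^sup>2 = 1 + n \<Sum> (x i y i)\<^sup>2\<close> over unordered pairs, and splitting the pairs
  into edges of \<open>E\<close> and of \<open>F\<close> yields \<open>1 < a Y + b X\<close>.  On the other hand the energy of \<open>x\<close> on the
  path bounds \<open>X\<close> in terms of \<open>a\<close>; with the help of the remaining vertices one gets \<open>b X \<le> a\<close> and
  \<open>a Y \<le> b\<close>, or a direct numerical contradiction.

  So \<open>a + b \<le> 1\<close> forces \<open>{a, b} = {0, 1}\<close>, and then a disconnected graph is complementary to a
  join, one side of which must be a single vertex.
\<close>

section \<open>Orthogonal diagonalisation of real symmetric matrices\<close>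

definition orthogonal_diag :: "nat \<Rightarrow> real mat \<Rightarrow> real mat \<Rightarrow> (nat \<Rightarrow> real) \<Rightarrow> bool" where
  "orthogonal_diag n A P d \<longleftrightarrow> P \<in> carrier_mat n n \<and> P\<^sup>T * P = 1\<^sub>m n \<and> A * P = P * mat_diag n d"

text \<open>The complexified matrix has an eigenpair \<open>l\<close>, \<open>z\<close>. Since
  \<open>A\<close> is real and symmetric, the Hermitian form \<open>?q\<close> of \<open>z\<close>
  equals its own conjugate, so \<open>l\<close> is real. Then the real and imaginary parts of
  \<open>z\<close> satisfy the eigenvalue equation separately, and one of them is nonzero.\<close>

lemma real_symmetric_eigenvector:
  fixes A :: "real mat"
  assumes A: "A \<in> carrier_mat n n" and sym: "A\<^sup>T = A" and n: "n > 0"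
  obtains w e where "w \<in> carrier_vec n" "w \<bullet> w = 1" "A *\<^sub>v w = e \<cdot>\<^sub>v w"
proof -
  let ?C = "map_mat complex_of_real A"
  have C: "?C \<in> carrier_mat n n" using A by simp
  have symA: "A $$ (i, j) = A $$ (j, i)" if "i < n" "j < n" for i j
    using arg_cong[OF sym, of "\<lambda>M. M $$ (i, j)"] A that by simp
  obtain l z where "eigenvector ?C z l"
    using spectrum_non_empty[OF C n] by (auto simp: spectrum_def eigenvalue_def)
  then have z: "z \<in> carrier_vec n" "z \<noteq> 0\<^sub>v n" "?C *\<^sub>v z = l \<cdot>\<^sub>v z"
    using C by (auto simp: eigenvector_def)
  have eq: "(\<Sum>j<n. complex_of_real (A $$ (i, j)) * z $ j) = l * z $ i" if "i < n" for i
    using arg_cong[OF z(3), of "\<lambda>v. v $ i"] that A z(1)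
    by (simp add: scalar_prod_def lessThan_atLeast0)
  define N where "N = (\<Sum>i<n. (cmod (z $ i))\<^sup>2)"
  have "\<exists>i<n. z $ i \<noteq> 0" using z(1,2) by (auto intro!: eq_vecI)
  then have N: "N > 0" unfolding N_def by (auto intro: sum_pos2)
  let ?q = "\<Sum>i<n. \<Sum>j<n. cnj (z $ i) * (complex_of_real (A $$ (i, j)) * z $ j)"
  have q1: "?q = l * of_real N"
    unfolding N_def of_real_sum sum_distrib_left
  proof (rule sum.cong[OF refl])
    fix i assume "i \<in> {..<n}"
    then have "(\<Sum>j<n. cnj (z $ i) * (complex_of_real (A $$ (i, j)) * z $ j)) = cnj (z $ i) * (l * z $ i)"
      using eq[of i] by (simp flip: sum_distrib_left)
    then show "(\<Sum>j<n. cnj (z $ i) * (complex_of_real (A $$ (i, j)) * z $ j))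
        = l * complex_of_real ((cmod (z $ i))\<^sup>2)"
      unfolding complex_norm_square by (simp add: mult_ac)
  qed
  have "cnj ?q = (\<Sum>i<n. \<Sum>j<n. z $ i * (complex_of_real (A $$ (i, j)) * cnj (z $ j)))" by simp
  also have "\<dots> = (\<Sum>j<n. \<Sum>i<n. z $ i * (complex_of_real (A $$ (i, j)) * cnj (z $ j)))"
    by (rule sum.swap)
  also have "\<dots> = ?q" using symA by (intro sum.cong) (auto simp: mult_ac)
  finally have "cnj l * of_real N = l * of_real N" using q1 by simp
  then have "cnj l = l" using N by simp
  then have l: "l = of_real (Re l)" by (simp add: complex_eq_iff)
  define e where "e = Re l"
  have re: "(\<Sum>j<n. A $$ (i, j) * Re (z $ j)) = e * Re (z $ i)" if "i < n" for i
    using arg_cong[OF eq[OF that], of Re] by (subst (asm) l) (simp add: e_def)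
  have im: "(\<Sum>j<n. A $$ (i, j) * Im (z $ j)) = e * Im (z $ i)" if "i < n" for i
    using arg_cong[OF eq[OF that], of Im] by (subst (asm) l) (simp add: e_def)
  obtain f where f: "\<And>i. i < n \<Longrightarrow> (\<Sum>j<n. A $$ (i, j) * f j) = e * f i" "\<exists>i<n. f i \<noteq> (0::real)"
  proof (cases "\<exists>i<n. Re (z $ i) \<noteq> 0")
    case True
    then show ?thesis using that[of "\<lambda>i. Re (z $ i)"] re by blast
  next
    case False
    then have "\<exists>i<n. Im (z $ i) \<noteq> 0" using \<open>\<exists>i<n. z $ i \<noteq> 0\<close> by (auto simp: complex_eq_iff)
    then show ?thesis using that[of "\<lambda>i. Im (z $ i)"] im by blast
  qed
  define S where "S = (\<Sum>i<n. (f i)\<^sup>2)"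
  have S: "S > 0" unfolding S_def using f(2) by (auto intro: sum_pos2)
  define w where "w = vec n (\<lambda>i. f i / sqrt S)"
  show ?thesis
  proof (rule that)
    show "w \<in> carrier_vec n" by (simp add: w_def)
    have "w \<bullet> w = (\<Sum>i<n. (f i)\<^sup>2 / S)"
      using S by (simp add: w_def scalar_prod_def lessThan_atLeast0 power2_eq_square)
    then show "w \<bullet> w = 1" using S by (simp add: S_def flip: sum_divide_distrib)
    show "A *\<^sub>v w = e \<cdot>\<^sub>v w"
    proof (rule eq_vecI)
      fix i assume "i < dim_vec (e \<cdot>\<^sub>v w)"
      then have i: "i < n" by (simp add: w_def)
      have "(A *\<^sub>v w) $ i = (\<Sum>j<n. A $$ (i, j) * f j / sqrt S)"
        using A i by (simp add: w_def scalar_prod_def lessThan_atLeast0)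
      also have "\<dots> = (e \<cdot>\<^sub>v w) $ i" using f(1)[OF i] i by (simp add: w_def flip: sum_divide_distrib)
      finally show "(A *\<^sub>v w) $ i = (e \<cdot>\<^sub>v w) $ i" .
    qed (use A in \<open>simp add: w_def\<close>)
  qed
qed

text \<open>The reflection exchanging \<open>w\<close> and the first unit vector.  If they agree, then \<open>U = 0\<close> and the
  division by zero turns \<open>W\<close> into the identity.\<close>

lemma householder_reflection:
  fixes w :: "real vec"
  assumes w: "w \<in> carrier_vec n" "w \<bullet> w = 1" and n: "n > 0"
  obtains W where "W \<in> carrier_mat n n" "W\<^sup>T = W" "W * W = 1\<^sub>m n" "col W 0 = w"
proof -
  define u where "u i = w $ i - (if i = 0 then 1 else 0)" for i
  define U where "U = (\<Sum>i<n. (u i)\<^sup>2)"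
  define c where "c = 2 / U"
  define W where "W = mat n n (\<lambda>(i, j). (if i = j then 1 else 0) - c * u i * u j)"
  have W: "W \<in> carrier_mat n n" by (simp add: W_def)
  \<comment> \<open>Also true for \<open>U = 0\<close>, where \<open>c = 2 / 0 = 0\<close>.\<close>
  have cU: "c * c * U = 2 * c" by (simp add: c_def)
  have "(\<Sum>i<n. (w $ i)\<^sup>2) = 1"
    using w by (simp add: scalar_prod_def lessThan_atLeast0 power2_eq_square)
  moreover have "U = (\<Sum>i<n. (w $ i)\<^sup>2 + (if i = 0 then 1 - 2 * w $ 0 else 0))"
    unfolding U_def u_def by (intro sum.cong) (auto simp: power2_eq_square algebra_simps)
  \<comment> \<open>The squared distance of two unit vectors, here
    \<open>2 - 2 * w $ 0\<close>.\<close>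
  ultimately have U: "U = - 2 * u 0"
    using n by (simp add: sum.distrib u_def)
  have cu: "c * u 0 * u i = - u i" if "i < n" for i
  proof (cases "U = 0")
    case True
    then have "(u i)\<^sup>2 = 0" using that unfolding U_def by (subst (asm) sum_nonneg_eq_0_iff) auto
    then show ?thesis by simp
  next
    case False
    then show ?thesis using U by (simp add: c_def field_simps)
  qed
  show ?thesis
  proof (rule that[OF W])
    show "W\<^sup>T = W" by (rule eq_matI) (auto simp: W_def)
    show "W * W = 1\<^sub>m n"
    proof (rule eq_matI)
      fix i j assume ij: "i < dim_row (1\<^sub>m n)" "j < dim_col (1\<^sub>m n)"
      then have ij': "i < n" "j < n" by auto
      have "(W * W) $$ (i, j) = (\<Sum>l<n. ((if i = l then 1 else 0) - c * u i * u l) * ((if l = j then 1 else 0) - c * u l * u j))"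
        using ij' by (simp add: W_def scalar_prod_def lessThan_atLeast0)
      also have "\<dots> = (\<Sum>l<n. (if l = i then (if i = j then 1 else 0) - c * u i * u j else 0)
          + (if l = j then - c * u i * u j else 0) + c * c * u i * u j * (u l)\<^sup>2)"
        by (intro sum.cong) (auto simp: power2_eq_square algebra_simps)
      also have "\<dots> = (if i = j then 1 else 0) - 2 * c * u i * u j + c * c * U * (u i * u j)"
        using ij' by (simp add: sum.distrib U_def sum_distrib_left algebra_simps)
      also have "\<dots> = 1\<^sub>m n $$ (i, j)" unfolding cU using ij' by simp
      finally show "(W * W) $$ (i, j) = 1\<^sub>m n $$ (i, j)" .
    qed (use W in auto)
    show "col W 0 = w"
    proof (rule eq_vecI)
      fix i assume "i < dim_vec w"
      then have i: "i < n" using w by simp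
      have "col W 0 $ i = (if i = 0 then 1 else 0) - c * u 0 * u i"
        using i n by (simp add: W_def mult_ac)
      then show "col W 0 $ i = w $ i" unfolding cu[OF i] by (simp add: u_def)
    qed (use W w in auto)
  qed
qed

text \<open>Conjugation by the reflection \<open>W\<close>, which exchanges \<open>w\<close> and the
  first unit vector, splits \<open>e\<close> off as a corner block, and the hypothesis
  \<open>IH\<close> diagonalises the other block. As \<open>Q\<close> fixes the first unit vector,
  \<open>W * Q\<close> still has first column \<open>w\<close>.\<close>

lemma orthogonal_diag_deflate:
  fixes A :: "real mat"
  assumes A: "A \<in> carrier_mat (Suc m) (Suc m)" and sym: "A\<^sup>T = A"
    and w: "w \<in> carrier_vec (Suc m)" "w \<bullet> w = 1" "A *\<^sub>v w = e \<cdot>\<^sub>v w"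
    and IH: "\<And>A' :: real mat. A' \<in> carrier_mat m m \<Longrightarrow> A'\<^sup>T = A' \<Longrightarrow> \<exists>P d. orthogonal_diag m A' P d"
  obtains P d where "orthogonal_diag (Suc m) A P d" "col P 0 = w" "d 0 = e"
proof -
  let ?n = "Suc m"
  obtain W where W: "W \<in> carrier_mat ?n ?n" "W\<^sup>T = W" "W * W = 1\<^sub>m ?n" "col W 0 = w"
    using householder_reflection[OF w(1,2)] by blast
  define B where "B = W * (A * W)"
  have B: "B \<in> carrier_mat ?n ?n" using A W by (simp add: B_def)
  have symB: "B\<^sup>T = B"
    using A W sym by (simp add: B_def transpose_mult[of _ ?n ?n _ ?n])
  have "col B 0 = W *\<^sub>v col (A * W) 0"
    unfolding B_def using A W(1) by (intro col_mult2[of _ ?n ?n _ ?n]) auto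
  also have "col (A * W) 0 = A *\<^sub>v w"
    by (subst col_mult2[of _ ?n ?n _ ?n]) (use A W in auto)
  also have "W *\<^sub>v (A *\<^sub>v w) = e \<cdot>\<^sub>v (W *\<^sub>v w)"
    unfolding w(3) by (rule mult_mat_vec[OF W(1) w(1)])
  also have "W *\<^sub>v w = col (W * W) 0" using col_mult2[of W ?n ?n W ?n 0] W by simp
  finally have colB: "col B 0 = e \<cdot>\<^sub>v unit_vec ?n 0" using W by simp
  have B0: "B $$ (i, 0) = (if i = 0 then e else 0)" "B $$ (0, i) = (if i = 0 then e else 0)" if "i < ?n" for i
  proof -
    show 1: "B $$ (i, 0) = (if i = 0 then e else 0)"
      using arg_cong[OF colB, of "\<lambda>v. v $ i"] that B by auto
    show "B $$ (0, i) = (if i = 0 then e else 0)"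
      using arg_cong[OF symB, of "\<lambda>M. M $$ (i, 0)"] that B 1 by simp
  qed
  define A2 where "A2 = mat m m (\<lambda>(i, j). B $$ (Suc i, Suc j))"
  have A2: "A2 \<in> carrier_mat m m" by (simp add: A2_def)
  have symA2: "A2\<^sup>T = A2"
  proof (rule eq_matI)
    fix i j assume "i < dim_row A2" "j < dim_col A2"
    then show "A2\<^sup>T $$ (i, j) = A2 $$ (i, j)"
      using arg_cong[OF symB, of "\<lambda>M. M $$ (Suc i, Suc j)"] B by (simp add: A2_def)
  qed (auto simp: A2_def)
  obtain P2 d2 where "orthogonal_diag m A2 P2 d2" using IH[OF A2 symA2] by blast
  then have P2: "P2 \<in> carrier_mat m m" "P2\<^sup>T * P2 = 1\<^sub>m m" "A2 * P2 = P2 * mat_diag m d2"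
    by (auto simp: orthogonal_diag_def)
  define d where "d i = (case i of 0 \<Rightarrow> e | Suc k \<Rightarrow> d2 k)" for i
  let ?e = "mat 1 1 (\<lambda>_. e)"
  have Bblock: "B = four_block_mat ?e (0\<^sub>m 1 m) (0\<^sub>m m 1) A2"
    using B B0 by (intro eq_matI) (auto simp: A2_def less_Suc_eq_0_disj)
  define Q where "Q = four_block_mat (1\<^sub>m 1) (0\<^sub>m 1 m) (0\<^sub>m m 1) P2"
  have Q: "Q \<in> carrier_mat ?n ?n" using P2 by (auto simp: Q_def)
  have Dblock: "mat_diag ?n d = four_block_mat ?e (0\<^sub>m 1 m) (0\<^sub>m m 1) (mat_diag m d2)"
    by (intro eq_matI) (auto simp: mat_diag_def d_def split: nat.split)
  have QtQ: "Q\<^sup>T * Q = 1\<^sub>m ?n"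
  proof -
    have QT: "Q\<^sup>T = four_block_mat (1\<^sub>m 1) (0\<^sub>m 1 m) (0\<^sub>m m 1) (P2\<^sup>T)"
      unfolding Q_def using P2(1) by (subst transpose_four_block_mat[of _ 1 1 _ m _ m]) auto
    have "Q\<^sup>T * Q = four_block_mat (1\<^sub>m 1) (0\<^sub>m 1 m) (0\<^sub>m m 1) (1\<^sub>m m)"
      unfolding QT unfolding Q_def using P2 by (subst mult_four_block_mat[of _ 1 1 _ m _ m _ _ 1 _ m]) auto
    then show ?thesis by (simp add: four_block_one_mat)
  qed
  have BQ: "B * Q = Q * mat_diag ?n d"
  proof -
    have "B * Q = four_block_mat ?e (0\<^sub>m 1 m) (0\<^sub>m m 1) (A2 * P2)"
      unfolding Bblock Q_def using P2(1) A2
      by (subst mult_four_block_mat[of _ 1 1 _ m _ m _ _ 1 _ m]) auto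
    also have "\<dots> = Q * mat_diag ?n d"
      unfolding Dblock Q_def P2(3) using P2(1)
      by (subst mult_four_block_mat[of _ 1 1 _ m _ m _ _ 1 _ m])
        (auto simp: left_mult_zero_mat[OF mat_diag_dim])
    finally show ?thesis .
  qed
  define P where "P = W * Q"
  have P: "P \<in> carrier_mat ?n ?n" using W Q by (simp add: P_def)
  have Qt: "Q\<^sup>T \<in> carrier_mat ?n ?n" using Q by simp
  have WWQ: "W * (W * Q) = Q"
    using W Q by (simp add: assoc_mult_mat[symmetric, of W ?n ?n W ?n Q ?n])
  have "P\<^sup>T * P = Q\<^sup>T * (W * (W * Q))"
    using W Q Qt by (simp add: P_def transpose_mult[of W ?n ?n Q ?n] assoc_mult_mat[of "Q\<^sup>T" ?n ?n W ?n "W * Q" ?n])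
  then have 1: "P\<^sup>T * P = 1\<^sub>m ?n" using WWQ QtQ by simp
  have AW: "A * W = W * B"
    using W A by (simp add: B_def assoc_mult_mat[symmetric, of W ?n ?n W ?n "A * W" ?n])
  have "A * P = (A * W) * Q" using A W Q by (simp add: P_def assoc_mult_mat[of A ?n ?n W ?n Q ?n])
  also have "\<dots> = W * (B * Q)" unfolding AW using W B Q by (simp add: assoc_mult_mat[of W ?n ?n B ?n Q ?n])
  also have "\<dots> = P * mat_diag ?n d"
    unfolding BQ P_def using W Q by (simp add: assoc_mult_mat[of W ?n ?n Q ?n "mat_diag ?n d" ?n])
  finally have 2: "A * P = P * mat_diag ?n d" .
  have "col Q 0 = unit_vec ?n 0"
    using P2(1) by (intro eq_vecI) (auto simp: Q_def)
  then have "col P 0 = W *\<^sub>v unit_vec ?n 0"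
    unfolding P_def using W(1) Q by (subst col_mult2[of _ ?n ?n _ ?n]) auto
  also have "\<dots> = w" using col_mult2[of W ?n ?n "1\<^sub>m ?n" ?n 0] W by simp
  finally have 3: "col P 0 = w" .
  show ?thesis using that[of P d] P 1 2 3 by (simp add: orthogonal_diag_def d_def)
qed

theorem real_symmetric_orthogonal_diag:
  fixes A :: "real mat"
  assumes "A \<in> carrier_mat n n" "A\<^sup>T = A"
  shows "\<exists>P d. orthogonal_diag n A P d"
  using assms
proof (induction n arbitrary: A)
  case 0
  then show ?case by (intro exI[of _ "1\<^sub>m 0"] exI[of _ "\<lambda>_. 0"]) (auto simp: orthogonal_diag_def mat_diag_def intro!: eq_matI)
next
  case (Suc m)
  obtain w e where "w \<in> carrier_vec (Suc m)" "w \<bullet> w = 1" "A *\<^sub>v w = e \<cdot>\<^sub>v w"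
    using real_symmetric_eigenvector[OF Suc.prems] by blast
  then show ?case using orthogonal_diag_deflate[OF Suc.prems _ _ _ Suc.IH] by metis
qed

text \<open>Prescribing the first column allows the constant function, a null function of every
  Laplacian, to be put at index \<open>0\<close>; all other eigenfunctions of the basis then have
  mean zero.\<close>

theorem orthogonal_diag_with_eigenvector:
  fixes A :: "real mat"
  assumes "A \<in> carrier_mat n n" "A\<^sup>T = A" "n > 0" "w \<in> carrier_vec n" "w \<bullet> w = 1" "A *\<^sub>v w = e \<cdot>\<^sub>v w"
  obtains P d where "orthogonal_diag n A P d" "col P 0 = w" "d 0 = e"
  using orthogonal_diag_deflate[of A "n - 1" w e] real_symmetric_orthogonal_diag assms by (metis Suc_diff_1)

lemma orthogonal_diag_inverse:
  assumes "orthogonal_diag n A P d" shows "P * P\<^sup>T = 1\<^sub>m n"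
  using assms mat_mult_left_right_inverse[of "P\<^sup>T" n P] by (auto simp: orthogonal_diag_def)

lemma char_poly_orthogonal_diag:
  assumes A: "A \<in> carrier_mat n n" and P: "orthogonal_diag n A P d"
  shows "char_poly A = (\<Prod>x\<leftarrow>map d [0..<n]. [:- x, 1:])"
proof -
  have P': "P \<in> carrier_mat n n" "P\<^sup>T * P = 1\<^sub>m n" "A * P = P * mat_diag n d"
    using P by (auto simp: orthogonal_diag_def)
  note inv = orthogonal_diag_inverse[OF P]
  have "A = A * (P * P\<^sup>T)" using A inv by simp
  also have "\<dots> = P * mat_diag n d * P\<^sup>T"
    using A P' by (simp flip: assoc_mult_mat[of A n n P n "P\<^sup>T" n])
  finally have eq: "A = P * mat_diag n d * P\<^sup>T" .
  have "similar_mat A (mat_diag n d)"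
    using A P' inv eq by (intro similar_matI[of _ _ P "P\<^sup>T" n]) auto
  then have "char_poly A = char_poly (mat_diag n d)" by (rule char_poly_similar)
  also have "\<dots> = (\<Prod>x\<leftarrow>diag_mat (mat_diag n d). [:- x, 1:])"
    by (rule char_poly_upper_triangular[of _ n]) (auto simp: mat_diag_def)
  also have "diag_mat (mat_diag n d) = map d [0..<n]"
    by (auto simp: diag_mat_def mat_diag_def intro!: nth_equalityI)
  finally show ?thesis .
qed

section \<open>Eigenfunctions of graph Laplacians\<close>

text \<open>The Dirichlet form over ordered pairs: every edge counts twice, hence the factors
  \<open>2\<close> further on.\<close>

definition lap_energy :: "'a set \<Rightarrow> ('a \<Rightarrow> 'a \<Rightarrow> bool) \<Rightarrow> ('a \<Rightarrow> real) \<Rightarrow> real" where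
  "lap_energy V E x = (\<Sum>i\<in>V. \<Sum>j\<in>V. if E i j then (x i - x j)\<^sup>2 else 0)"

definition lap_eigen :: "'a set \<Rightarrow> ('a \<Rightarrow> 'a \<Rightarrow> bool) \<Rightarrow> real \<Rightarrow> ('a \<Rightarrow> real) \<Rightarrow> bool" where
  "lap_eigen V E a x \<longleftrightarrow> (\<forall>i\<in>V. (\<Sum>j\<in>V. if E i j then x i - x j else 0) = a * x i)"

text \<open>Adding \<open>x i * (x i - x j)\<close> over the two orientations of an edge gives
  \<open>(x i - x j)\<^sup>2\<close>.\<close>

lemma lap_energy_inner:
  assumes "\<And>i j. i \<in> V \<Longrightarrow> j \<in> V \<Longrightarrow> E i j \<longleftrightarrow> E j i"
  shows "lap_energy V E x = 2 * (\<Sum>i\<in>V. x i * (\<Sum>j\<in>V. if E i j then x i - x j else 0))"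
proof -
  let ?g = "\<lambda>i j. if E i j then x i * (x i - x j) else 0"
  have "lap_energy V E x = (\<Sum>i\<in>V. \<Sum>j\<in>V. ?g i j + ?g j i)"
    unfolding lap_energy_def
    by (intro sum.cong refl) (auto simp: assms power2_eq_square algebra_simps)
  also have "\<dots> = (\<Sum>i\<in>V. \<Sum>j\<in>V. ?g i j) + (\<Sum>i\<in>V. \<Sum>j\<in>V. ?g j i)"
    by (simp add: sum.distrib)
  also have "(\<Sum>i\<in>V. \<Sum>j\<in>V. ?g j i) = (\<Sum>i\<in>V. \<Sum>j\<in>V. ?g i j)"
    by (rule sum.swap)
  also have "(\<Sum>i\<in>V. \<Sum>j\<in>V. ?g i j) + (\<Sum>i\<in>V. \<Sum>j\<in>V. ?g i j)
      = 2 * (\<Sum>i\<in>V. x i * (\<Sum>j\<in>V. if E i j then x i - x j else 0))"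
    by (simp add: sum_distrib_left if_distrib cong: if_cong)
  finally show ?thesis .
qed

lemma lap_energy_eigen:
  assumes "\<And>i j. i \<in> V \<Longrightarrow> j \<in> V \<Longrightarrow> E i j \<longleftrightarrow> E j i" and "lap_eigen V E a x"
  shows "lap_energy V E x = 2 * a * (\<Sum>i\<in>V. (x i)\<^sup>2)"
proof -
  have "(\<Sum>i\<in>V. x i * (\<Sum>j\<in>V. if E i j then x i - x j else 0)) = (\<Sum>i\<in>V. a * (x i)\<^sup>2)"
    using assms(2) unfolding lap_eigen_def by (intro sum.cong) (auto simp: power2_eq_square)
  then show ?thesis using lap_energy_inner[of V E x, OF assms(1)] by (simp add: sum_distrib_left mult.assoc)
qed

text \<open>\<open>S\<close> selects one orientation of some edges; together with its disjoint
  converse it accounts for a part of the nonnegative summands.\<close>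

lemma lap_energy_ge_edges:
  assumes fin: "finite V" and sym: "\<And>i j. i \<in> V \<Longrightarrow> j \<in> V \<Longrightarrow> E i j \<longleftrightarrow> E j i"
    and S: "S \<subseteq> V \<times> V" "\<And>i j. (i, j) \<in> S \<Longrightarrow> E i j" "\<And>i j. (i, j) \<in> S \<Longrightarrow> (j, i) \<notin> S"
  shows "2 * (\<Sum>(i, j)\<in>S. (x i - x j)\<^sup>2) \<le> lap_energy V E x"
proof -
  let ?f = "\<lambda>(i, j). (x i - x j)\<^sup>2" and ?h = "\<lambda>(i, j). if E i j then (x i - x j)\<^sup>2 else 0"
  have finS: "finite S" using S(1) fin by (meson finite_SigmaI finite_subset)
  have "(\<Sum>p\<in>S\<inverse>. ?f p) = (\<Sum>p\<in>S. ?f p)"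
    by (rule sum.reindex_bij_witness[of _ prod.swap prod.swap]) (auto simp: power2_commute)
  then have "2 * (\<Sum>p\<in>S. ?f p) = (\<Sum>p\<in>S. ?f p) + (\<Sum>p\<in>S\<inverse>. ?f p)" by simp
  also have "\<dots> = (\<Sum>p\<in>S \<union> S\<inverse>. ?f p)"
    using finS S(3) by (intro sum.union_disjoint[symmetric]) auto
  also have "\<dots> = (\<Sum>p\<in>S \<union> S\<inverse>. ?h p)"
  proof (rule sum.cong[OF refl])
    fix p assume "p \<in> S \<union> S\<inverse>"
    then show "?f p = ?h p" using S(1,2) sym by (cases p) fastforce
  qed
  also have "\<dots> \<le> (\<Sum>p\<in>V \<times> V. ?h p)"
    using fin S(1) by (intro sum_mono2) (auto split: if_splits)
  also have "\<dots> = lap_energy V E x"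
    unfolding lap_energy_def by (simp add: sum.cartesian_product)
  finally show ?thesis .
qed

text \<open>Subtract the eigenvalue equation at \<open>v\<close> from the one at \<open>u\<close>.
  By extremality every summand is nonnegative, so the sum may be restricted to any
  \<open>T\<close>.\<close>

lemma eigen_extremes:
  assumes fin: "finite V" and eig: "lap_eigen V E a x" and uv: "u \<in> V" "v \<in> V"
    and max: "\<And>i. i \<in> V \<Longrightarrow> x i \<le> x u" and min: "\<And>i. i \<in> V \<Longrightarrow> x v \<le> x i" and T: "T \<subseteq> V"
  shows "(\<Sum>j\<in>T. (if E u j then x u - x j else 0) + (if E v j then x j - x v else 0))
      \<le> a * (x u - x v)"
proof -
  have "(\<Sum>j\<in>T. (if E u j then x u - x j else 0) + (if E v j then x j - x v else 0))
      \<le> (\<Sum>j\<in>V. (if E u j then x u - x j else 0) + (if E v j then x j - x v else 0))"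
    using fin T max min by (intro sum_mono2) auto
  also have "\<dots> = (\<Sum>j\<in>V. if E u j then x u - x j else 0) - (\<Sum>j\<in>V. if E v j then x v - x j else 0)"
    unfolding sum_subtractf[symmetric] by (intro sum.cong) auto
  also have "\<dots> = a * (x u - x v)"
    using eig uv unfolding lap_eigen_def by (simp add: algebra_simps)
  finally show ?thesis .
qed

text \<open>An edge \<open>u v\<close>, or a common neighbour \<open>w\<close>, would alone
  contribute \<open>x u - x v\<close> to the sum in \<open>eigen_extremes\<close>, which is at most
  \<open>a * (x u - x v)\<close>.\<close>

lemma eigen_lt_one_extremes:
  assumes fin: "finite V" and eig: "lap_eigen V E a x" and a: "a < 1" and uv: "u \<in> V" "v \<in> V"
    and sym: "\<And>i j. i \<in> V \<Longrightarrow> j \<in> V \<Longrightarrow> E i j \<longleftrightarrow> E j i"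
    and max: "\<And>i. i \<in> V \<Longrightarrow> x i \<le> x u" and min: "\<And>i. i \<in> V \<Longrightarrow> x v \<le> x i" and lt: "x v < x u"
  shows "\<not> E u v" and "w \<in> V \<Longrightarrow> E u w \<Longrightarrow> \<not> E v w"
proof -
  have small: "a * (x u - x v) < x u - x v" using a lt by simp
  note ext = eigen_extremes[OF fin eig uv max min]
  show "\<not> E u v" using ext[of "{v}"] uv small max[of v] by (auto split: if_splits)
  show "\<not> E v w" if "w \<in> V" "E u w" using ext[of "{w}"] uv small that by auto
qed

text \<open>In the expansion every term with a factor \<open>\<Sum>i\<in>V. x i\<close>,
  \<open>\<Sum>i\<in>V. y i\<close> or \<open>\<Sum>i\<in>V. x i * y i\<close> vanishes.\<close>

lemma sum_sq_diff_prod: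
  fixes x y :: "'a \<Rightarrow> real"
  assumes "finite V" "(\<Sum>i\<in>V. x i) = 0" "(\<Sum>i\<in>V. y i) = 0" "(\<Sum>i\<in>V. x i * y i) = 0"
  shows "(\<Sum>i\<in>V. \<Sum>j\<in>V. (x i - x j)\<^sup>2 * (y i - y j)\<^sup>2)
    = 2 * (\<Sum>i\<in>V. (x i)\<^sup>2) * (\<Sum>i\<in>V. (y i)\<^sup>2) + 2 * card V * (\<Sum>i\<in>V. (x i * y i)\<^sup>2)"
proof -
  let ?xx = "\<Sum>i\<in>V. (x i)\<^sup>2" and ?yy = "\<Sum>i\<in>V. (y i)\<^sup>2" and ?p = "\<Sum>i\<in>V. (x i * y i)\<^sup>2"
  have inner: "(\<Sum>j\<in>V. (x i - x j)\<^sup>2 * (y i - y j)\<^sup>2) =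
      card V * (x i * y i)\<^sup>2 + (x i)\<^sup>2 * ?yy + (y i)\<^sup>2 * ?xx + ?p
      - 2 * x i * (\<Sum>j\<in>V. x j * (y j)\<^sup>2) - 2 * y i * (\<Sum>j\<in>V. (x j)\<^sup>2 * y j)" for i
  proof -
    have "(\<Sum>j\<in>V. (x i - x j)\<^sup>2 * (y i - y j)\<^sup>2) =
      (\<Sum>j\<in>V. (x i * y i)\<^sup>2 + (x i)\<^sup>2 * (y j)\<^sup>2 + (y i)\<^sup>2 * (x j)\<^sup>2 + (x j * y j)\<^sup>2
        - 2 * x i * (x j * (y j)\<^sup>2) - 2 * y i * ((x j)\<^sup>2 * y j)
        - (2 * (x i)\<^sup>2 * y i) * y j - (2 * x i * (y i)\<^sup>2) * x j + (4 * x i * y i) * (x j * y j))"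
      by (intro sum.cong) (auto simp: power2_eq_square algebra_simps)
    also have "\<dots> = card V * (x i * y i)\<^sup>2 + (x i)\<^sup>2 * ?yy + (y i)\<^sup>2 * ?xx + ?p
      - 2 * x i * (\<Sum>j\<in>V. x j * (y j)\<^sup>2) - 2 * y i * (\<Sum>j\<in>V. (x j)\<^sup>2 * y j)
      - (2 * (x i)\<^sup>2 * y i) * (\<Sum>j\<in>V. y j) - (2 * x i * (y i)\<^sup>2) * (\<Sum>j\<in>V. x j)
      + (4 * x i * y i) * (\<Sum>j\<in>V. x j * y j)"
      by (simp add: sum.distrib sum_subtractf sum_distrib_left)
    finally show ?thesis using assms by simp
  qed
  have "(\<Sum>i\<in>V. \<Sum>j\<in>V. (x i - x j)\<^sup>2 * (y i - y j)\<^sup>2) =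
     card V * ?p + ?xx * ?yy + ?yy * ?xx + card V * ?p
     - 2 * (\<Sum>i\<in>V. x i) * (\<Sum>j\<in>V. x j * (y j)\<^sup>2) - 2 * (\<Sum>i\<in>V. y i) * (\<Sum>j\<in>V. (x j)\<^sup>2 * y j)"
    unfolding inner
    by (simp add: sum.distrib sum_subtractf flip: sum_distrib_left sum_distrib_right)
  then show ?thesis using assms by (simp add: algebra_simps)
qed

text \<open>With \<open>t = 1 - b \<ge> a\<close> everything reduces to one polynomial inequality in \<open>b\<close>, which in
  terms of \<open>s = b - 1/2\<close> is \<open>41/4 s\<^sup>4 - 4 s\<^sup>3 + 11/8 s\<^sup>2 + 1/64 \<ge> 0\<close>; the tails \<open>b < 1/3\<close> and
  \<open>b > 2/3\<close> use cruder bounds.\<close>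

lemma quartic_bound:
  fixes a b X Y \<rho> \<pi> :: real
  assumes "a + b \<le> 1" "0 \<le> a" "0 \<le> b" "0 \<le> \<rho>" "\<rho> \<le> a" "0 \<le> \<pi>" "\<pi> \<le> b" "0 \<le> X" "0 \<le> Y"
    and X: "X * (1 - 2 * \<rho> + 3/2 * \<rho>\<^sup>2) \<le> a"
    and Y: "Y * (1 - 2 * \<pi> + 3/2 * \<pi>\<^sup>2 + 2 * (1 - b)\<^sup>2) \<le> b"
  shows "a * Y + b * X \<le> 1"
proof -
  define t where "t = 1 - b"
  have at: "a \<le> t" "0 \<le> t" "t \<le> 1" using assms t_def by auto
  \<comment> \<open>Lower bounds \<open>A0\<close> and \<open>B0\<close> for the two brackets give
    \<open>X \<le> t / A0\<close> and \<open>Y \<le> b / B0\<close>, so that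
    \<open>t * Y + b * X \<le> t * b * (1 / A0 + 1 / B0)\<close>.\<close>
  have main: ?thesis if A: "A0 > 0" "A0 \<le> 1 - 2 * \<rho> + 3/2 * \<rho>\<^sup>2"
    and B: "B0 > 0" "B0 \<le> 1 - 2 * \<pi> + 3/2 * \<pi>\<^sup>2 + 2 * t\<^sup>2"
    and poly: "t * b * (A0 + B0) \<le> A0 * B0" for A0 B0
  proof -
    have "X * A0 \<le> X * (1 - 2 * \<rho> + 3/2 * \<rho>\<^sup>2)" by (rule mult_left_mono) (use A assms in auto)
    then have 1: "X * A0 \<le> t" using X at by linarith
    have "Y * B0 \<le> Y * (1 - 2 * \<pi> + 3/2 * \<pi>\<^sup>2 + 2 * t\<^sup>2)" by (rule mult_left_mono) (use B assms in auto)
    then have 2: "Y * B0 \<le> b" using Y t_def by simp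
    have "(t * Y + b * X) * (A0 * B0) = t * A0 * (Y * B0) + b * B0 * (X * A0)" by (simp add: algebra_simps)
    also have "\<dots> \<le> t * A0 * b + b * B0 * t"
      using 1 2 A B at assms by (intro add_mono mult_left_mono) auto
    also have "\<dots> \<le> 1 * (A0 * B0)" using poly by (simp add: algebra_simps)
    finally have "t * Y + b * X \<le> 1" using A B by (simp add: mult_le_cancel_right)
    moreover have "a * Y \<le> t * Y" using at assms by (intro mult_right_mono) auto
    ultimately show ?thesis by linarith
  qed
  \<comment> \<open>The minimum of the parabola, attained at \<open>2/3\<close>; to the left of it
    the parabola decreases.\<close>
  have third: "1/3 \<le> 1 - 2 * z + 3/2 * z\<^sup>2" for z :: real
    using zero_le_power2[of "z - 2/3"] by (simp add: power2_eq_square algebra_simps)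
  have decr: "1 - 2 * s + 3/2 * s\<^sup>2 \<le> 1 - 2 * z + 3/2 * z\<^sup>2" if "z \<le> s" "s \<le> 2/3" for z s :: real
  proof -
    have "(s - z) * (2 - 3/2 * (s + z)) \<ge> 0" using that by (intro mult_nonneg_nonneg) auto
    moreover have "(s - z) * (2 - 3/2 * (s + z)) = (1 - 2 * z + 3/2 * z\<^sup>2) - (1 - 2 * s + 3/2 * s\<^sup>2)"
      by (simp add: power2_eq_square field_simps)
    ultimately show ?thesis by linarith
  qed
  consider "b < 1/3" | "1/3 \<le> b" "b \<le> 2/3" | "2/3 < b" by linarith
  then show ?thesis
  proof cases
    case 1
    have "b * t \<le> 2/9"
    proof -
      have "(1/3 - b) * (2/3 - b) \<ge> 0" using 1 by (intro mult_nonneg_nonneg) auto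
      moreover have "(1/3 - b) * (2/3 - b) = 2/9 - b * t" by (simp add: t_def field_simps)
      ultimately show ?thesis by linarith
    qed
    moreover have "t\<^sup>2 \<ge> (2/3)\<^sup>2" using 1 t_def by (intro power_mono) auto
    moreover have "1 - 2 * (1/3) + 3/2 * (1/3)\<^sup>2 \<le> 1 - 2 * \<pi> + 3/2 * \<pi>\<^sup>2"
      using 1 assms by (intro decr) auto
    \<comment> \<open>\<open>1/3\<close> is the global minimum of the parabola, and
      \<open>4/3\<close> lies below \<open>1/2 + 2 * (2/3)\<^sup>2\<close>.\<close>
    ultimately show ?thesis
      using third[of \<rho>] by (intro main[of "1/3" "4/3"]) (auto simp: power2_eq_square)
  next
    case 2
    define s where "s = b - 1/2"
    have "t * b * ((1 - 2 * t + 3/2 * t\<^sup>2) + (1 - 2 * b + 3/2 * b\<^sup>2 + 2 * t\<^sup>2))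
        \<le> (1 - 2 * t + 3/2 * t\<^sup>2) * (1 - 2 * b + 3/2 * b\<^sup>2 + 2 * t\<^sup>2)"
    proof -
      have "(1 - 2 * t + 3/2 * t\<^sup>2) * (1 - 2 * b + 3/2 * b\<^sup>2 + 2 * t\<^sup>2) -
         t * b * ((1 - 2 * t + 3/2 * t\<^sup>2) + (1 - 2 * b + 3/2 * b\<^sup>2 + 2 * t\<^sup>2))
         = s\<^sup>2 * (41/4 * (s - 8/41)\<^sup>2 + (11/8 - 16/41)) + 1/64"
        unfolding t_def s_def by (simp add: power2_eq_square field_simps)
      also have "\<dots> \<ge> 0" by (simp add: add_nonneg_nonneg)
      finally show ?thesis by simp
    qed
    moreover have "1 - 2 * t + 3/2 * t\<^sup>2 \<le> 1 - 2 * \<rho> + 3/2 * \<rho>\<^sup>2"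
      using 2 assms at by (intro decr) (auto simp: t_def)
    moreover have "1 - 2 * b + 3/2 * b\<^sup>2 \<le> 1 - 2 * \<pi> + 3/2 * \<pi>\<^sup>2"
      using 2 assms by (intro decr) auto
    moreover have "1 - 2 * b + 3/2 * b\<^sup>2 + 2 * t\<^sup>2 > 0" using third[of b] zero_le_power2[of t] by linarith
    ultimately show ?thesis
      using third[of t]
      by (intro main[of "1 - 2 * t + 3/2 * t\<^sup>2" "1 - 2 * b + 3/2 * b\<^sup>2 + 2 * t\<^sup>2"]) auto
  next
    case 3
    have t3: "t < 1/3" using 3 t_def by simp
    \<comment> \<open>Here \<open>\<rho> \<le> t < 1/3\<close>, and the parabola has the value
      \<open>1/2\<close> at \<open>1/3\<close>.\<close>
    have "1 - 2 * (1/3) + 3/2 * (1/3)\<^sup>2 \<le> 1 - 2 * \<rho> + 3/2 * \<rho>\<^sup>2"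
      using t3 at assms by (intro decr) auto
    moreover have "t * b * (1/2 + (1/3 + 2 * t\<^sup>2)) \<le> 1/2 * (1/3 + 2 * t\<^sup>2)"
    proof -
      have "1/2 * (1/3 + 2 * t\<^sup>2) - t * b * (1/2 + (1/3 + 2 * t\<^sup>2))
          = 1/6 * (7 * (t - 5/14)\<^sup>2 + 3/28 + t\<^sup>2 * (4 - 12 * t) + 12 * t\<^sup>2 * t\<^sup>2)"
        unfolding t_def by (simp add: power2_eq_square field_simps)
      also have "\<dots> \<ge> 0" using t3 by (intro mult_nonneg_nonneg add_nonneg_nonneg) auto
      finally show ?thesis by simp
    qed
    ultimately show ?thesis
      using third[of \<pi>] by (intro main[of "1/2" "1/3 + 2 * t\<^sup>2"]) (auto simp: power2_eq_square add_pos_nonneg)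
  qed
qed

section \<open>Two complementary eigenfunctions\<close>

text \<open>The assumptions will turn out to be contradictory. They are stable under exchanging
  \<open>E\<close>, \<open>a\<close>, \<open>x\<close> with \<open>F\<close>, \<open>b\<close>,
  \<open>y\<close> and under negating \<open>x\<close>, so that symmetric cases are obtained by
  reinterpretation.\<close>

locale complementary_eigenfuns =
  fixes V :: "'a set" and E F :: "'a \<Rightarrow> 'a \<Rightarrow> bool" and a b :: real and x y :: "'a \<Rightarrow> real"
  assumes fin: "finite V"
    and E_sym: "\<And>i j. i \<in> V \<Longrightarrow> j \<in> V \<Longrightarrow> E i j \<longleftrightarrow> E j i"
    and E_irrefl: "\<And>i. i \<in> V \<Longrightarrow> \<not> E i i"
    and F_iff: "\<And>i j. i \<in> V \<Longrightarrow> j \<in> V \<Longrightarrow> F i j \<longleftrightarrow> i \<noteq> j \<and> \<not> E i j"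
    and eig_x: "lap_eigen V E a x" and eig_y: "lap_eigen V F b y"
    and sum_x: "(\<Sum>i\<in>V. x i) = 0" and sum_y: "(\<Sum>i\<in>V. y i) = 0"
    and norm_x: "(\<Sum>i\<in>V. (x i)\<^sup>2) = 1" and norm_y: "(\<Sum>i\<in>V. (y i)\<^sup>2) = 1"
    and orth: "(\<Sum>i\<in>V. x i * y i) = 0"
    and a_lt: "a < 1" and b_lt: "b < 1" and ab_le: "a + b \<le> 1"
begin

lemma F_sym: "i \<in> V \<Longrightarrow> j \<in> V \<Longrightarrow> F i j \<longleftrightarrow> F j i"
  using E_sym F_iff by blast

lemma energy_x: "lap_energy V E x = 2 * a" and energy_y: "lap_energy V F y = 2 * b"
  using lap_energy_eigen[OF E_sym eig_x] lap_energy_eigen[OF F_sym eig_y] norm_x norm_y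
  by simp_all

lemma swap: "complementary_eigenfuns V F E b a y x"
  using fin F_sym F_iff E_irrefl eig_x eig_y sum_x sum_y norm_x norm_y orth a_lt b_lt ab_le
  by unfold_locales (auto simp: mult.commute)

lemma uminus: "complementary_eigenfuns V E F a b (\<lambda>i. - x i) y"
proof -
  have "(\<Sum>j\<in>V. if E i j then - x i - - x j else 0) = - (\<Sum>j\<in>V. if E i j then x i - x j else 0)" for i
    unfolding sum_negf[symmetric] by (intro sum.cong) auto
  then have "lap_eigen V E a (\<lambda>i. - x i)" using eig_x unfolding lap_eigen_def by simp
  then show ?thesis
    using fin E_sym F_iff E_irrefl eig_y sum_x sum_y norm_x norm_y orth a_lt b_lt ab_le
    by unfold_locales (auto simp: sum_negf)
qed

text \<open>The maximum exceeds the minimum strictly because a constant function of mean zero cannot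
  have norm one.\<close>

lemma exists_extremes:
  obtains u v where "u \<in> V" "v \<in> V" "\<And>i. i \<in> V \<Longrightarrow> x i \<le> x u" "\<And>i. i \<in> V \<Longrightarrow> x v \<le> x i" "x v < x u"
proof -
  have ne: "V \<noteq> {}" using norm_x by auto
  have "Max (x ` V) \<in> x ` V" using ne fin by (intro Max_in) auto
  then obtain u where "u \<in> V" "x u = Max (x ` V)" by auto
  then have u: "u \<in> V" "\<And>i. i \<in> V \<Longrightarrow> x i \<le> x u" using fin by simp_all
  have "Min (x ` V) \<in> x ` V" using ne fin by (intro Min_in) auto
  then obtain v where "v \<in> V" "x v = Min (x ` V)" by auto
  then have v: "v \<in> V" "\<And>i. i \<in> V \<Longrightarrow> x v \<le> x i" using fin by simp_all
  have "x v < x u"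
  proof (rule ccontr)
    assume "\<not> x v < x u"
    then have eq: "x i = x u" if "i \<in> V" for i using u v that by (metis antisym linorder_not_less order_trans)
    then have "(\<Sum>i\<in>V. x i) = card V * x u" by simp
    then have "x u = 0" using sum_x ne fin by simp
    then show False using norm_x eq by simp
  qed
  then show ?thesis using that u v by blast
qed

end

text \<open>The six adjacencies say that \<open>u - c - d - v\<close> is an induced path of \<open>E\<close>, i.e. \<open>c - v - u - d\<close>
  is one of \<open>F\<close>.\<close>

locale extremal_path = complementary_eigenfuns +
  fixes u c d v :: 'a
  assumes mem: "u \<in> V" "c \<in> V" "d \<in> V" "v \<in> V"
    and x_max: "\<And>i. i \<in> V \<Longrightarrow> x i \<le> x u" and x_min: "\<And>i. i \<in> V \<Longrightarrow> x v \<le> x i" and x_lt: "x v < x u"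
    and y_max: "\<And>i. i \<in> V \<Longrightarrow> y i \<le> y c" and y_min: "\<And>i. i \<in> V \<Longrightarrow> y d \<le> y i" and y_lt: "y d < y c"
    and path: "E u c" "E c d" "E d v" "F c v" "F v u" "F u d"
begin

text \<open>Affine rescalings of \<open>x\<close> and \<open>y\<close> to the range from
  \<open>0\<close> to \<open>1\<close>; the factors \<open>X\<close> and \<open>Y\<close> convert
  squared differences back.\<close>

definition "\<xi> i = (x i - x v) / (x u - x v)"
definition "\<eta> i = (y i - y d) / (y c - y d)"
definition "X = (x u - x v)\<^sup>2"
definition "Y = (y c - y d)\<^sup>2"

lemma distinct: "u \<noteq> c" "u \<noteq> d" "u \<noteq> v" "c \<noteq> d" "c \<noteq> v" "d \<noteq> v"
  using path mem F_iff E_irrefl by blast+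

text \<open>The path \<open>c - v - u - d\<close> of \<open>F\<close> starts where \<open>y\<close>
  is maximal, and its second vertex \<open>v\<close> has to maximise the second function: hence
  \<open>- x\<close>.\<close>

lemma dual: "extremal_path V F E b a y (\<lambda>i. - x i) c v u d"
proof -
  interpret m: complementary_eigenfuns V E F a b "\<lambda>i. - x i" y by (rule uminus)
  interpret s: complementary_eigenfuns V F E b a y "\<lambda>i. - x i" by (rule m.swap)
  show ?thesis
    using mem x_max x_min x_lt y_max y_min y_lt path E_sym F_sym
    by unfold_locales auto
qed

text \<open>Walking along the path from \<open>v\<close> to \<open>u\<close> exchanges maxima and
  minima of both functions.\<close>

lemma reverse: "extremal_path V E F a b (\<lambda>i. - x i) (\<lambda>i. - y i) v d c u"
proof -
  interpret m: complementary_eigenfuns V E F a b "\<lambda>i. - x i" y by (rule uminus)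
  interpret s: complementary_eigenfuns V F E b a y "\<lambda>i. - x i" by (rule m.swap)
  interpret m2: complementary_eigenfuns V F E b a "\<lambda>i. - y i" "\<lambda>i. - x i" by (rule s.uminus)
  interpret s2: complementary_eigenfuns V E F a b "\<lambda>i. - x i" "\<lambda>i. - y i" by (rule m2.swap)
  show ?thesis
    using mem x_max x_min x_lt y_max y_min y_lt path E_sym F_sym
    by unfold_locales auto
qed

lemma xi_simps [simp]: "\<xi> u = 1" "\<xi> v = 0" "\<eta> c = 1" "\<eta> d = 0"
  using x_lt y_lt by (simp_all add: \<xi>_def \<eta>_def)

lemma xi_range: "i \<in> V \<Longrightarrow> 0 \<le> \<xi> i" "i \<in> V \<Longrightarrow> \<xi> i \<le> 1"
  using x_max x_min x_lt by (auto simp: \<xi>_def field_simps)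

lemma X_pos: "X > 0" and Y_pos: "Y > 0"
  using x_lt y_lt by (simp_all add: X_def Y_def)

lemma x_diff: "(x i - x j)\<^sup>2 = X * (\<xi> i - \<xi> j)\<^sup>2"
proof -
  have "\<xi> i - \<xi> j = (x i - x j) / (x u - x v)"
    by (simp add: \<xi>_def diff_divide_distrib)
  then have "x i - x j = (x u - x v) * (\<xi> i - \<xi> j)"
    using x_lt by simp
  then show ?thesis by (simp add: X_def power_mult_distrib)
qed

lemma linear_bound:
  assumes "T \<subseteq> V"
  shows "(\<Sum>j\<in>T. (if E u j then 1 - \<xi> j else 0) + (if E v j then \<xi> j else 0)) \<le> a"
proof -
  let ?R = "x u - x v"
  have "?R * (\<Sum>j\<in>T. (if E u j then 1 - \<xi> j else 0) + (if E v j then \<xi> j else 0))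
    = (\<Sum>j\<in>T. (if E u j then x u - x j else 0) + (if E v j then x j - x v else 0))"
  proof -
    have "?R * (1 - \<xi> j) = x u - x j" "?R * \<xi> j = x j - x v" for j
      using x_lt by (simp_all add: \<xi>_def right_diff_distrib[of _ 1])
    then show ?thesis unfolding sum_distrib_left by (intro sum.cong) (auto simp: distrib_left)
  qed
  also have "\<dots> \<le> ?R * a"
    using eigen_extremes[OF fin eig_x mem(1,4) x_max x_min assms] by (simp add: mult.commute)
  finally show ?thesis using x_lt by simp
qed

lemma not_adj: "\<not> E u d" "\<not> E v c" "\<not> E u v" "\<not> E d u" "\<not> E c v" "\<not> E v u"
  using path F_iff E_sym mem by blast+

text \<open>On the path, \<open>u\<close> sees only \<open>c\<close> and \<open>v\<close> only
  \<open>d\<close>, so the two end edges use up at most \<open>a\<close> of the total drop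
  \<open>1\<close>. The middle edge keeps at least \<open>1 - a > 0\<close>.\<close>

lemma end_gaps: "(1 - \<xi> c) + \<xi> d \<le> a"
proof -
  have "E v d" using path E_sym mem by blast
  then show ?thesis
    using linear_bound[of "{c, d}"] mem distinct path not_adj by simp
qed

lemma energy_bound:
  assumes "S \<subseteq> V \<times> V" "\<And>i j. (i, j) \<in> S \<Longrightarrow> E i j" "\<And>i j. (i, j) \<in> S \<Longrightarrow> (j, i) \<notin> S"
  shows "X * (\<Sum>(i, j)\<in>S. (\<xi> i - \<xi> j)\<^sup>2) \<le> a"
proof -
  have "X * (\<Sum>(i, j)\<in>S. (\<xi> i - \<xi> j)\<^sup>2) = (\<Sum>(i, j)\<in>S. (x i - x j)\<^sup>2)"
    unfolding sum_distrib_left by (intro sum.cong) (auto simp: x_diff)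
  then show ?thesis
    using lap_energy_ge_edges[of V E S x, OF fin E_sym assms] energy_x by simp
qed

text \<open>A detour of \<open>E\<close> through \<open>w\<close> bridges the gap \<open>D\<close> between \<open>c\<close> and \<open>d\<close> a second time; the
  extra energy \<open>D\<^sup>2 / 2\<close> completes a square.\<close>

lemma crossing_vertex_bound:
  assumes w: "w \<in> V" "w \<notin> {u, c, d, v}" and p: "p \<in> {u, c}" "E w p" and q: "q \<in> {d, v}" "E w q"
  shows "b * X \<le> a"
proof -
  define r s where "r = 1 - \<xi> c" and "s = \<xi> d"
  define z where "z = \<xi> w"
  have rs: "0 \<le> r" "0 \<le> s" "r + s \<le> a" using xi_range mem end_gaps by (auto simp: r_def s_def)
  let ?S = "{(u, c), (c, d), (d, v), (w, p), (w, q)}"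
  have "X * (\<Sum>(i, j)\<in>?S. (\<xi> i - \<xi> j)\<^sup>2) \<le> a"
    using w p q mem path distinct by (intro energy_bound) auto
  moreover have "(\<Sum>(i, j)\<in>?S. (\<xi> i - \<xi> j)\<^sup>2)
      = r\<^sup>2 + (1 - r - s)\<^sup>2 + s\<^sup>2 + (z - \<xi> p)\<^sup>2 + (z - \<xi> q)\<^sup>2"
    using w p q distinct by (auto simp: r_def s_def z_def)
  moreover have "1 - a \<le> r\<^sup>2 + (1 - r - s)\<^sup>2 + s\<^sup>2 + (z - \<xi> p)\<^sup>2 + (z - \<xi> q)\<^sup>2"
  proof -
    define D where "D = 1 - r - s"
    have D0: "0 < D" using rs a_lt by (simp add: D_def)
    \<comment> \<open>\<open>\<xi> p\<close> is at least \<open>\<xi> c\<close> and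
      \<open>\<xi> q\<close> is at most \<open>\<xi> d\<close>.\<close>
    have "D \<le> \<xi> p - \<xi> q" using p(1) q(1) rs by (auto simp: D_def r_def s_def)
    then have "D\<^sup>2 \<le> (\<xi> p - \<xi> q)\<^sup>2" using D0 by (intro power_mono) auto
    also have "\<dots> \<le> 2 * ((z - \<xi> p)\<^sup>2 + (z - \<xi> q)\<^sup>2)"
      using zero_le_power2[of "(z - \<xi> p) + (z - \<xi> q)"] by (simp add: power2_eq_square algebra_simps)
    finally have 1: "D\<^sup>2 / 2 \<le> (z - \<xi> p)\<^sup>2 + (z - \<xi> q)\<^sup>2" by simp
    have 2: "(1 - D)\<^sup>2 / 2 \<le> r\<^sup>2 + s\<^sup>2"
      using zero_le_power2[of "r - s"] by (simp add: D_def power2_eq_square field_simps)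
    \<comment> \<open>The two sides differ by \<open>(2 * D - 1)\<^sup>2 / 2\<close>; moreover
      \<open>D \<ge> 1 - a\<close> by \<open>end_gaps\<close>.\<close>
    have "D \<le> D\<^sup>2 + D\<^sup>2 / 2 + (1 - D)\<^sup>2 / 2"
      using zero_le_power2[of "2 * D - 1"] by (simp add: power2_eq_square field_simps)
    then show ?thesis using 1 2 rs(3) unfolding D_def by linarith
  qed
  moreover have "b * X \<le> X * (1 - a)" using ab_le X_pos by (simp add: mult.commute)
  ultimately have "X * (r\<^sup>2 + (1 - r - s)\<^sup>2 + s\<^sup>2 + (z - \<xi> p)\<^sup>2 + (z - \<xi> q)\<^sup>2) \<le> a"
      "X * (1 - a) \<le> X * (r\<^sup>2 + (1 - r - s)\<^sup>2 + s\<^sup>2 + (z - \<xi> p)\<^sup>2 + (z - \<xi> q)\<^sup>2)"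
      "b * X \<le> X * (1 - a)"
    using X_pos by (simp_all only: mult_left_mono less_imp_le)
  then show ?thesis by linarith
qed

text \<open>For end gaps \<open>r\<close> and \<open>s\<close>,
  \<open>r\<^sup>2 + s\<^sup>2 \<ge> (r + s)\<^sup>2 / 2\<close>, so the energy of the path is
  bounded in terms of \<open>r + s\<close> alone, in the form that \<open>quartic_bound\<close>
  expects.\<close>

lemma three_path_bound:
  "X * (1 - 2 * (1 - \<xi> c + \<xi> d) + 3/2 * (1 - \<xi> c + \<xi> d)\<^sup>2) \<le> a"
proof -
  define r s where "r = 1 - \<xi> c" and "s = \<xi> d"
  let ?S = "{(u, c), (c, d), (d, v)}"
  have "X * (\<Sum>(i, j)\<in>?S. (\<xi> i - \<xi> j)\<^sup>2) \<le> a"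
    using mem path distinct by (intro energy_bound) auto
  moreover have "(\<Sum>(i, j)\<in>?S. (\<xi> i - \<xi> j)\<^sup>2) = r\<^sup>2 + (1 - r - s)\<^sup>2 + s\<^sup>2"
    using distinct by (auto simp: r_def s_def)
  moreover have "1 - 2 * (r + s) + 3/2 * (r + s)\<^sup>2 \<le> r\<^sup>2 + (1 - r - s)\<^sup>2 + s\<^sup>2"
    using zero_le_power2[of "r - s"] by (simp add: power2_eq_square field_simps)
  ultimately have "X * (r\<^sup>2 + (1 - r - s)\<^sup>2 + s\<^sup>2) \<le> a"
      "X * (1 - 2 * (r + s) + 3/2 * (r + s)\<^sup>2) \<le> X * (r\<^sup>2 + (1 - r - s)\<^sup>2 + s\<^sup>2)"
    using X_pos by (simp_all only: mult_left_mono less_imp_le)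
  then have "X * (1 - 2 * (r + s) + 3/2 * (r + s)\<^sup>2) \<le> a" by linarith
  then show ?thesis by (simp add: r_def s_def)
qed

lemma a_nonneg: "0 \<le> a"
  using end_gaps xi_range[of c] xi_range[of d] mem by linarith

text \<open>By \<open>sum_sq_diff_prod\<close> the sum of the products over ordered pairs exceeds
  \<open>2\<close>. Bounding the \<open>y\<close>-factor by \<open>Y\<close> on edges of
  \<open>E\<close> and the \<open>x\<close>-factor by \<open>X\<close> on edges of \<open>F\<close>
  leaves the two energies.\<close>

lemma product_bound: "1 < a * Y + b * X"
proof -
  \<comment> \<open>Strictness needs one nonzero product \<open>x k * y k\<close>: as
    \<open>x\<close> differs at \<open>c\<close> and \<open>d\<close>, it is nonzero at one of them,
    and \<open>y\<close> is nonzero at both.\<close>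
  have "x c \<noteq> x d"
  proof
    assume "x c = x d"
    then show False using end_gaps a_lt by (simp add: \<xi>_def)
  qed
  moreover have "y c > 0" "y d < 0"
  proof -
    show "y c > 0"
    proof (rule ccontr)
      assume "\<not> y c > 0"
      then have "y i \<le> 0" if "i \<in> V" for i using y_max[OF that] by linarith
      moreover have "y d < 0" using \<open>\<not> y c > 0\<close> y_lt by linarith
      ultimately have "(\<Sum>i\<in>V. y i) < (\<Sum>i\<in>V. 0)" using fin mem by (intro sum_strict_mono_ex1) auto
      then show False using sum_y by simp
    qed
    show "y d < 0"
    proof (rule ccontr)
      assume "\<not> y d < 0"
      then have "y i \<ge> 0" if "i \<in> V" for i using y_min[OF that] by linarith
      moreover have "y c > 0" using \<open>\<not> y d < 0\<close> y_lt by linarith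
      ultimately have "(\<Sum>i\<in>V. 0) < (\<Sum>i\<in>V. y i)" using fin mem by (intro sum_strict_mono_ex1) auto
      then show False using sum_y by simp
    qed
  qed
  ultimately obtain k where "k \<in> V" "x k * y k \<noteq> 0" using mem by (metis less_irrefl mult_eq_0_iff)
  then have "(\<Sum>i\<in>V. (x i * y i)\<^sup>2) > 0" using fin by (intro sum_pos2[of V k]) auto
  moreover have "card V > 0" using fin mem by (auto simp: card_gt_0_iff)
  ultimately have "2 < (\<Sum>i\<in>V. \<Sum>j\<in>V. (x i - x j)\<^sup>2 * (y i - y j)\<^sup>2)"
    using sum_sq_diff_prod[OF fin sum_x sum_y orth] norm_x norm_y by simp
  also have "\<dots> \<le> (\<Sum>i\<in>V. \<Sum>j\<in>V. Y * (if E i j then (x i - x j)\<^sup>2 else 0)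
      + X * (if F i j then (y i - y j)\<^sup>2 else 0))"
  proof (intro sum_mono)
    fix i j assume ij: "i \<in> V" "j \<in> V"
    have "(x i - x j)\<^sup>2 \<le> X" unfolding X_def abs_le_square_iff[symmetric]
      using x_max[OF ij(1)] x_max[OF ij(2)] x_min[OF ij(1)] x_min[OF ij(2)] by linarith
    moreover have "(y i - y j)\<^sup>2 \<le> Y" unfolding Y_def abs_le_square_iff[symmetric]
      using y_max[OF ij(1)] y_max[OF ij(2)] y_min[OF ij(1)] y_min[OF ij(2)] by linarith
    ultimately show "(x i - x j)\<^sup>2 * (y i - y j)\<^sup>2 \<le> Y * (if E i j then (x i - x j)\<^sup>2 else 0)
      + X * (if F i j then (y i - y j)\<^sup>2 else 0)"
      using F_iff[OF ij] X_pos Y_pos mult_left_mono[of "(y i - y j)\<^sup>2" Y "(x i - x j)\<^sup>2"]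
        mult_right_mono[of "(x i - x j)\<^sup>2" X "(y i - y j)\<^sup>2"]
      by (cases "i = j") (auto simp: mult.commute)
  qed
  also have "\<dots> = Y * lap_energy V E x + X * lap_energy V F y"
    by (simp add: sum.distrib sum_distrib_left lap_energy_def)
  finally show ?thesis using energy_x energy_y by (simp add: algebra_simps)
qed

end

section \<open>Vertices outside the path\<close>

context extremal_path
begin

definition others :: "'a set" where "others = V - {u, c, d, v}"

text \<open>The vertices that provide the detour in \<open>crossing_vertex_bound\<close>.\<close>

definition crossing :: "'a \<Rightarrow> bool" where
  "crossing w \<longleftrightarrow> (\<exists>p\<in>{u, c}. E w p) \<and> (\<exists>q\<in>{d, v}. E w q)"

text \<open>\<open>c\<close> and \<open>d\<close> have no common neighbour in \<open>F\<close>, and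
  \<open>u\<close> and \<open>v\<close> have none in \<open>E\<close>.\<close>

lemma others_adj:
  assumes "w \<in> others"
  shows "E w c \<or> E w d" "\<not> (E w u \<and> E w v)"
proof -
  have w: "w \<in> V" "w \<noteq> c" "w \<noteq> d" using assms by (auto simp: others_def)
  have "\<not> (F c w \<and> F d w)"
    using eigen_lt_one_extremes(2)[OF fin eig_y b_lt mem(2,3) F_sym y_max y_min y_lt] w by blast
  then show "E w c \<or> E w d" using w F_iff E_sym mem by metis
  have "\<not> (E u w \<and> E v w)"
    using eigen_lt_one_extremes(2)[OF fin eig_x a_lt mem(1,4) E_sym x_max x_min x_lt] w by blast
  then show "\<not> (E w u \<and> E w v)" using w E_sym mem by metis
qed

text \<open>\<open>w\<close> is joined to \<open>c\<close> or \<open>d\<close>, and then to nothing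
  in the other half of the path. The two cases are mirror images under
  \<open>reverse\<close>.\<close>

lemma not_crossing_cases:
  assumes "w \<in> others" "\<not> crossing w"
  obtains "E w c" "\<not> E w d" "\<not> E w v" "F w d" "F w v" "\<not> F w c"
    | "E w d" "\<not> E w c" "\<not> E w u" "F w c" "F w u" "\<not> F w d"
proof -
  have w: "w \<in> V" "w \<noteq> u" "w \<noteq> c" "w \<noteq> d" "w \<noteq> v" using assms by (auto simp: others_def)
  have "(E w c \<and> \<not> E w d \<and> \<not> E w v) \<or> (E w d \<and> \<not> E w c \<and> \<not> E w u)"
    using others_adj[OF assms(1)] assms(2) by (auto simp: crossing_def)
  then show ?thesis using that w F_iff mem by blast
qed

text \<open>\<open>E\<close> is exactly the path. The equations at \<open>u\<close>,
  \<open>c\<close>, \<open>d\<close> express all values through \<open>x u\<close>, and mean zero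
  yields \<open>k * k\<^sup>2 + 3 * k\<^sup>2 + k = 1\<close> for \<open>k = 1 - a\<close>, which
  fails for \<open>k \<ge> 1/2\<close>.\<close>

lemma four_vertices:
  assumes V: "V = {u, c, d, v}"
  shows "1/2 < a"
proof -
  define k where "k = 1 - a"
  have adj: "E c u" "E d c" "E v d" using path E_sym mem by blast+
  have ir: "\<not> E u u" "\<not> E c c" "\<not> E d d" "\<not> E v v" using E_irrefl mem by auto
  have eq: "\<And>i. i \<in> V \<Longrightarrow> (\<Sum>j\<in>V. if E i j then x i - x j else 0) = a * x i"
    using eig_x by (simp add: lap_eigen_def)
  have 1: "x u - x c = (1 - k) * x u"
    using eq[OF mem(1)] distinct path not_adj adj ir by (simp add: V k_def)
  have 2: "(x c - x u) + (x c - x d) = (1 - k) * x c"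
    using eq[OF mem(2)] distinct path not_adj adj ir by (simp add: V k_def)
  have 3: "(x d - x c) + (x d - x v) = (1 - k) * x d"
    using eq[OF mem(3)] distinct path not_adj adj ir by (simp add: V k_def)
  have 4: "x u + x c + x d + x v = 0" using sum_x distinct by (simp add: V)
  have xc: "x c = k * x u" using 1 by (simp add: algebra_simps)
  have xd: "x d = ((1 + k) * k - 1) * x u" using 2 unfolding xc by (simp add: algebra_simps)
  have xv: "x v = ((1 + k) * ((1 + k) * k - 1) - k) * x u" using 3 unfolding xc xd by (simp add: algebra_simps)
  have ne: "x u \<noteq> 0" using x_lt xv by auto
  have "(k * k\<^sup>2 + 3 * k\<^sup>2 + k - 1) * x u = 0"
    using 4 unfolding xc xd xv by (simp add: algebra_simps power2_eq_square)
  then have z: "k * k\<^sup>2 + 3 * k\<^sup>2 + k = 1" using ne by simp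
  have "k < 1/2"
  proof (rule ccontr)
    assume k: "\<not> k < 1/2"
    then have "k\<^sup>2 \<ge> (1/2)\<^sup>2" by (intro power_mono) auto
    moreover have "(1/2)\<^sup>2 = (1/4 :: real)" by (simp add: power2_eq_square)
    moreover have "k * k\<^sup>2 \<ge> 0" using k by simp
    ultimately show False using z k by linarith
  qed
  then show ?thesis by (simp add: k_def)
qed

text \<open>Apart from a possible edge between them, \<open>u\<close> and \<open>w\<close> have the
  same neighbours, in \<open>E\<close> as in \<open>F\<close>. So both eigenfunctions agree on
  \<open>u\<close> and \<open>w\<close>, and the rest is solved as for four vertices.\<close>

lemma five_vertices:
  assumes V: "V = {u, c, d, v, w}" and w: "w \<in> others"
    and E_w: "E w c" "\<not> E w d" "\<not> E w v" and F_w: "F w d" "F w v" "\<not> F w c"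
  shows "1/2 < a" "1/2 < b"
proof -
  have dist: "w \<noteq> u" "w \<noteq> c" "w \<noteq> d" "w \<noteq> v" "u \<noteq> w" "c \<noteq> w" "d \<noteq> w" "v \<noteq> w" and wV: "w \<in> V"
    using w by (auto simp: others_def)
  note ne = dist distinct distinct[symmetric]
  have ir: "\<not> E i i" "\<not> F i i" if "i \<in> V" for i using E_irrefl F_iff that by auto
  have E_adj: "E c u" "E d c" "E v d" "E c w" "\<not> E d w" "\<not> E v w" "E w u \<longleftrightarrow> E u w"
    using path E_w E_sym mem wV by blast+
  have F_adj: "F v c" "F u v" "F d u" "F d w" "F v w" "\<not> F c w" "F w u \<longleftrightarrow> F u w"
      "\<not> F c d" "\<not> F d c" "\<not> F u c" "\<not> F c u" "\<not> F d v" "\<not> F v d"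
    using path F_w F_sym F_iff mem wV E_adj by blast+
  note E_simps = path E_w E_adj not_adj
  note F_simps = path F_w F_adj
  have eq: "\<And>i. i \<in> V \<Longrightarrow> (\<Sum>j\<in>V. if E i j then x i - x j else 0) = a * x i"
    using eig_x by (simp add: lap_eigen_def)
  have eqF: "\<And>i. i \<in> V \<Longrightarrow> (\<Sum>j\<in>V. if F i j then y i - y j else 0) = b * y i"
    using eig_y by (simp add: lap_eigen_def)
  show "1/2 < a"
  proof -
    define k where "k = 1 - a"
    have k: "0 < k" using a_lt by (simp add: k_def)
    have u: "x u - x c + (if E u w then x u - x w else 0) = (1 - k) * x u"
      using eq[OF mem(1)] ne E_simps ir mem by (simp add: V k_def)
    have w: "x w - x c + (if E u w then x w - x u else 0) = (1 - k) * x w"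
      using eq[OF wV] ne E_simps ir mem wV by (simp add: V k_def add.commute)
    \<comment> \<open>The difference of the equations at \<open>u\<close> and \<open>w\<close>; an
      edge \<open>u w\<close> adds \<open>2\<close> to the coefficient, which is positive in any
      case.\<close>
    have "(k + (if E u w then 2 else 0)) * x u = (k + (if E u w then 2 else 0)) * x w"
      using u w by (cases "E u w") (simp_all add: algebra_simps)
    then have uw: "x w = x u" using k by (auto split: if_splits)
    have c: "(x c - x u) + (x c - x d) + (x c - x w) = (1 - k) * x c"
      using eq[OF mem(2)] ne E_simps ir mem by (simp add: V k_def)
    have d: "(x d - x c) + (x d - x v) = (1 - k) * x d"
      using eq[OF mem(3)] ne E_simps ir mem by (simp add: V k_def)
    have s: "x u + x c + x d + x v + x w = 0" using sum_x ne by (simp add: V)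
    have xc: "x c = k * x u" using u uw by (cases "E u w") (simp_all add: algebra_simps)
    have xd: "x d = ((2 + k) * k - 2) * x u" using c unfolding xc uw by (simp add: algebra_simps)
    have xv: "x v = ((1 + k) * ((2 + k) * k - 2) - k) * x u"
      using d unfolding xc xd by (simp add: algebra_simps)
    have ne0: "x u \<noteq> 0" using x_lt xv by auto
    have "(k * k\<^sup>2 + 4 * k\<^sup>2 + 2 * k - 2) * x u = 0"
      using s unfolding xc xd xv uw by (simp add: algebra_simps power2_eq_square)
    then have z: "k * k\<^sup>2 + 4 * k\<^sup>2 + 2 * k = 2" using ne0 by simp
    have "k < 1/2"
    proof (rule ccontr)
      assume k2: "\<not> k < 1/2"
      then have "k\<^sup>2 \<ge> (1/2)\<^sup>2" by (intro power_mono) auto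
      moreover have "(1/2)\<^sup>2 = (1/4 :: real)" by (simp add: power2_eq_square)
      moreover have "k * k\<^sup>2 > 0" using k by simp
      ultimately show False using z k2 by linarith
    qed
    then show ?thesis by (simp add: k_def)
  qed
  show "1/2 < b"
  proof -
    define k where "k = 1 - b"
    have k: "0 < k" using b_lt by (simp add: k_def)
    have u: "(y u - y v) + (y u - y d) + (if F u w then y u - y w else 0) = (1 - k) * y u"
      using eqF[OF mem(1)] ne F_simps ir mem by (simp add: V k_def)
    have w: "(y w - y v) + (y w - y d) + (if F u w then y w - y u else 0) = (1 - k) * y w"
      using eqF[OF wV] ne F_simps ir mem wV by (simp add: V k_def add.commute)
    have "(1 + k + (if F u w then 2 else 0)) * y u = (1 + k + (if F u w then 2 else 0)) * y w"
      using u w by (cases "F u w") (simp_all add: algebra_simps)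
    then have uw: "y w = y u" using k by (auto split: if_splits)
    have c: "y c - y v = (1 - k) * y c"
      using eqF[OF mem(2)] ne F_simps ir mem by (simp add: V k_def)
    have d: "(y d - y u) + (y d - y w) = (1 - k) * y d"
      using eqF[OF mem(3)] ne F_simps ir mem by (simp add: V k_def)
    have s: "y u + y c + y d + y v + y w = 0" using sum_y ne by (simp add: V)
    have yv: "y v = k * y c" using c by (simp add: algebra_simps)
    have yu: "2 * y u = (1 + k) * y d" using d uw by (simp add: algebra_simps)
    have yv2: "y v = (1 + k) * y u - y d" using u uw by (cases "F u w") (simp_all add: algebra_simps)
    have ne0: "y d \<noteq> 0"
    proof
      assume "y d = 0"
      then have "y u = 0" "y v = 0" using yu yv2 by auto
      then show False using s uw \<open>y d = 0\<close> y_lt by simp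
    qed
    have yv3: "2 * y v = ((1 + k) * (1 + k) - 2) * y d"
    proof -
      have "2 * y v = (1 + k) * (2 * y u) - 2 * y d" using yv2 by (simp add: algebra_simps)
      then show ?thesis unfolding yu by (simp add: algebra_simps)
    qed
    \<comment> \<open>Scaled by \<open>2 * k\<close> so that \<open>y c\<close> occurs only as
      \<open>k * y c = y v\<close> and \<open>y d\<close> remains as the sole unknown.\<close>
    have "2 * k * (y u + y w) + 2 * (k * y c) + 2 * k * y d + 2 * k * y v = 0"
      using arg_cong[OF s, of "\<lambda>t. 2 * k * t"] by (simp add: algebra_simps)
    then have "2 * k * ((1 + k) * y d) + 2 * y v + 2 * k * y d + k * (2 * y v) = 0"
      unfolding yv[symmetric] uw yu[symmetric] by (simp add: algebra_simps)
    then have "((1 + k) * ((1 + k)\<^sup>2 - 2) + 2 * k * (2 + k)) * y d = 0"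
      unfolding yv3 by (simp add: algebra_simps power2_eq_square)
    then have z: "(1 + k) * ((1 + k)\<^sup>2 - 2) + 2 * k * (2 + k) = 0" using ne0 by simp
    have "k < 1/2"
    proof (rule ccontr)
      assume "\<not> k < 1/2"
      then have "(1 + k)\<^sup>2 \<ge> (3/2)\<^sup>2" by (intro power_mono) auto
      then have "(1 + k) * ((1 + k)\<^sup>2 - 2) \<ge> 0" using k
        by (intro mult_nonneg_nonneg) (auto simp: power2_eq_square)
      then show False using z k by (smt (verit) mult_pos_pos)
    qed
    then show ?thesis by (simp add: k_def)
  qed
qed

text \<open>With at most one further vertex the eigenvalue equations can be solved and give \<open>a, b > 1/2\<close>.
  Otherwise two further vertices each contribute \<open>(1 - b)\<^sup>2\<close> to the energy of \<open>\<eta>\<close>.\<close>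

lemma no_crossing_False:
  assumes nc: "\<And>w. w \<in> others \<Longrightarrow> \<not> crossing w"
  shows False
proof -
  interpret D: extremal_path V F E b a y "\<lambda>i. - x i" c v u d by (rule dual)
  interpret R: extremal_path V E F a b "\<lambda>i. - x i" "\<lambda>i. - y i" v d c u by (rule reverse)
  have D_eqs: "D.\<xi> = \<eta>" "D.X = Y"
    by (auto simp: D.\<xi>_def \<eta>_def D.X_def Y_def)
  have R_others: "R.others = others" by (auto simp: R.others_def others_def)
  have finO: "finite others" using fin by (simp add: others_def)
  consider "others = {}" | w where "others = {w}" | w1 w2 where "w1 \<in> others" "w2 \<in> others" "w1 \<noteq> w2"
    by blast
  then show False
  proof cases
    case 1
    then have V: "V = {u, c, d, v}" "V = {c, v, u, d}" using mem by (auto simp: others_def)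
    show False using four_vertices[OF V(1)] D.four_vertices[OF V(2)] ab_le by linarith
  next
    case (2 w)
    then have w: "w \<in> others" and V: "V = {u, c, d, v, w}" "V = {v, d, c, u, w}"
      using mem by (auto simp: others_def)
    show False
    proof (cases rule: not_crossing_cases[OF w nc[OF w]])
      case 1
      then show False using five_vertices[OF V(1) w] ab_le by linarith
    next
      case 2
      then show False using R.five_vertices[OF V(2) w[folded R_others]] ab_le by linarith
    qed
  next
    case (3 w1 w2)
    \<comment> \<open>In \<open>F\<close>, \<open>w\<close> is adjacent to exactly one of
      \<open>c\<close> and \<open>d\<close>. Its term in \<open>linear_bound\<close> for the dual
      path forces \<open>\<eta> w\<close> to differ by at least \<open>1 - b\<close> from
      \<open>\<eta> v\<close> or \<open>\<eta> u\<close>, and \<open>w\<close> is adjacent in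
      \<open>F\<close> to that vertex.\<close>
    have far: "\<exists>t\<in>{u, v}. F w t \<and> (1 - b)\<^sup>2 \<le> (\<eta> w - \<eta> t)\<^sup>2" if w: "w \<in> others" for w
    proof -
      have wV: "w \<in> V" "w \<notin> {u, c, d, v}" using w by (auto simp: others_def)
      have rng: "0 \<le> \<eta> u" "\<eta> v \<le> 1" using D.xi_range mem unfolding D_eqs by auto
      have lin: "(\<Sum>j\<in>{v, u, w}. (if F c j then 1 - \<eta> j else 0) + (if F d j then \<eta> j else 0)) \<le> b"
        using D.linear_bound[of "{v, u, w}"] mem wV unfolding D_eqs by simp
      have Fd: "F d u" "\<not> F d v" "\<not> F c u" using path F_sym F_iff E_sym mem by blast+
      show ?thesis
      proof (cases rule: not_crossing_cases[OF w nc[OF w]])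
        case 1
        then have "F d w" "\<not> F c w" using F_sym wV mem by blast+
        then have "1 - b \<le> \<eta> v - \<eta> w" using lin wV distinct path Fd rng by auto
        then have "(1 - b)\<^sup>2 \<le> (\<eta> v - \<eta> w)\<^sup>2" using b_lt by (intro power_mono) auto
        then show ?thesis using 1 by (auto simp: power2_commute)
      next
        case 2
        then have "F c w" "\<not> F d w" using F_sym wV mem by blast+
        then have "1 - b \<le> \<eta> w - \<eta> u" using lin wV distinct path Fd rng by auto
        then have "(1 - b)\<^sup>2 \<le> (\<eta> w - \<eta> u)\<^sup>2" using b_lt by (intro power_mono) auto
        then show ?thesis using 2 by auto
      qed
    qed
    obtain t1 where t1: "t1 \<in> {u, v}" "F w1 t1" "(1 - b)\<^sup>2 \<le> (\<eta> w1 - \<eta> t1)\<^sup>2" using far 3 by blast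
    obtain t2 where t2: "t2 \<in> {u, v}" "F w2 t2" "(1 - b)\<^sup>2 \<le> (\<eta> w2 - \<eta> t2)\<^sup>2" using far 3 by blast
    have wV: "w1 \<in> V" "w1 \<notin> {u, c, d, v}" "w2 \<in> V" "w2 \<notin> {u, c, d, v}" using 3 by (auto simp: others_def)
    define p q where "p = 1 - \<eta> v" and "q = \<eta> u"
    have pq: "0 \<le> p" "0 \<le> q" "p + q \<le> b"
      using D.xi_range D.end_gaps mem unfolding D_eqs p_def q_def by auto
    \<comment> \<open>The path of \<open>F\<close> and one further edge at each of the two outside
      vertices.\<close>
    let ?S = "{(c, v), (v, u), (u, d), (w1, t1), (w2, t2)}"
    have "Y * (\<Sum>(i, j)\<in>?S. (\<eta> i - \<eta> j)\<^sup>2) \<le> b"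
      unfolding D_eqs(1,2)[symmetric] using mem path wV t1 t2 3 distinct by (intro D.energy_bound) auto
    moreover have "(\<Sum>(i, j)\<in>?S. (\<eta> i - \<eta> j)\<^sup>2)
        = p\<^sup>2 + (1 - p - q)\<^sup>2 + q\<^sup>2 + (\<eta> w1 - \<eta> t1)\<^sup>2 + (\<eta> w2 - \<eta> t2)\<^sup>2"
      using distinct wV t1(1) t2(1) 3(3) by (auto simp: p_def q_def)
    moreover have "1 - 2 * (p + q) + 3/2 * (p + q)\<^sup>2 + 2 * (1 - b)\<^sup>2
        \<le> p\<^sup>2 + (1 - p - q)\<^sup>2 + q\<^sup>2 + (\<eta> w1 - \<eta> t1)\<^sup>2 + (\<eta> w2 - \<eta> t2)\<^sup>2"
    proof -
      have "1 - 2 * (p + q) + 3/2 * (p + q)\<^sup>2 \<le> p\<^sup>2 + (1 - p - q)\<^sup>2 + q\<^sup>2"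
        using zero_le_power2[of "p - q"] by (simp add: power2_eq_square field_simps)
      then show ?thesis using t1(3) t2(3) by linarith
    qed
    ultimately have "Y * (p\<^sup>2 + (1 - p - q)\<^sup>2 + q\<^sup>2 + (\<eta> w1 - \<eta> t1)\<^sup>2 + (\<eta> w2 - \<eta> t2)\<^sup>2) \<le> b"
      "Y * (1 - 2 * (p + q) + 3/2 * (p + q)\<^sup>2 + 2 * (1 - b)\<^sup>2)
        \<le> Y * (p\<^sup>2 + (1 - p - q)\<^sup>2 + q\<^sup>2 + (\<eta> w1 - \<eta> t1)\<^sup>2 + (\<eta> w2 - \<eta> t2)\<^sup>2)"
      using Y_pos by (simp_all only: mult_left_mono less_imp_le)
    then have Y: "Y * (1 - 2 * (p + q) + 3/2 * (p + q)\<^sup>2 + 2 * (1 - b)\<^sup>2) \<le> b" by linarith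
    \<comment> \<open>In \<open>quartic_bound\<close>, \<open>\<rho>\<close> and
      \<open>\<pi>\<close> are the sums of the end gaps of the paths of \<open>E\<close> and
      \<open>F\<close>.\<close>
    have "a * Y + b * X \<le> 1"
      using three_path_bound Y end_gaps pq a_nonneg D.a_nonneg xi_range[of c] xi_range[of d] mem ab_le X_pos Y_pos
      by (intro quartic_bound[of a b "1 - \<xi> c + \<xi> d" "p + q"]) auto
    then show False using product_bound by linarith
  qed
qed

text \<open>There are crossing vertices for \<open>E\<close> and, by duality, for \<open>F\<close>.
  So \<open>b * X \<le> a\<close> and \<open>a * Y \<le> b\<close>, whose sum is at most
  \<open>1\<close>, against \<open>product_bound\<close>.\<close>

lemma contradiction: False
proof -
  interpret D: extremal_path V F E b a y "\<lambda>i. - x i" c v u d by (rule dual)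
  have "D.Y = X" "D.X = Y"
    by (auto simp: D.Y_def D.X_def X_def Y_def)
  note D_eqs = this
  have D_others: "D.others = others" by (auto simp: D.others_def others_def)
  obtain w where w: "w \<in> others" "crossing w" using no_crossing_False by blast
  then obtain p q where "p \<in> {u, c}" "E w p" "q \<in> {d, v}" "E w q" unfolding crossing_def by blast
  then have 1: "b * X \<le> a" using w(1) by (intro crossing_vertex_bound[of w p q]) (auto simp: others_def)
  obtain w' where w': "w' \<in> others" "D.crossing w'" using D.no_crossing_False D_others by blast
  then obtain p' q' where "p' \<in> {c, v}" "F w' p'" "q' \<in> {u, d}" "F w' q'" unfolding D.crossing_def by blast
  then have 2: "a * D.X \<le> b" using w'(1) by (intro D.crossing_vertex_bound[of w' p' q']) (auto simp: others_def)
  show False using 1 2 product_bound ab_le unfolding D_eqs by linarith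
qed

end

theorem (in complementary_eigenfuns) contradiction: False
proof -
  interpret S: complementary_eigenfuns V F E b a y x by (rule swap)
  obtain u v where uv: "u \<in> V" "v \<in> V" "\<And>i. i \<in> V \<Longrightarrow> x i \<le> x u" "\<And>i. i \<in> V \<Longrightarrow> x v \<le> x i" "x v < x u"
    using exists_extremes by blast
  obtain c d where cd: "c \<in> V" "d \<in> V" "\<And>i. i \<in> V \<Longrightarrow> y i \<le> y c" "\<And>i. i \<in> V \<Longrightarrow> y d \<le> y i" "y d < y c"
    using S.exists_extremes by blast
  note x_ext = eigen_lt_one_extremes[OF fin eig_x a_lt uv(1,2) E_sym uv(3-5)]
  note y_ext = eigen_lt_one_extremes[OF fin eig_y b_lt cd(1,2) F_sym cd(3-5)]
  have Fuv: "F u v" and Ecd: "E c d"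
    using x_ext(1) y_ext(1) uv cd F_iff by (metis less_irrefl)+
  have nE: "\<not> (E u w \<and> E v w)" and nF: "\<not> (F c w \<and> F d w)" if "w \<in> V" for w
    using x_ext(2) y_ext(2) that by blast+
  have tot: "i = j \<or> E i j \<or> F i j" and excl: "\<not> (E i j \<and> F i j)" if "i \<in> V" "j \<in> V" for i j
    using F_iff that by blast+
  note mem = uv(1,2) cd(1,2)
  \<comment> \<open>Excludes that \<open>p\<close> is extremal for both functions, with partners
    \<open>q\<close> for \<open>x\<close> and \<open>r\<close> for \<open>y\<close>: the pair
    \<open>q\<close>, \<open>r\<close> could neither coincide nor be an edge of \<open>E\<close> or
    \<open>F\<close>.\<close>
  have gen: False if "p \<in> V" "q \<in> V" "r \<in> V" "F p q" "E p r" "\<not> (E p r \<and> E q r)" "\<not> (F p q \<and> F r q)" for p q r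
    using that tot[of q r] excl[of p q] F_sym[of r q] by blast
  have Fvu: "F v u" and Edc: "E d c" using Fuv Ecd E_sym F_sym mem by blast+
  have d: "u \<noteq> c" "u \<noteq> d" "v \<noteq> c" "v \<noteq> d"
    using gen[of u v d] gen[of u v c] gen[of v u d] gen[of v u c] mem Fuv Fvu Ecd Edc nE nF by blast+
  have "E u c \<or> E u d" "E v c \<or> E v d" "\<not> (E u c \<and> E v c)" "\<not> (E u d \<and> E v d)"
    using nE nF mem d tot F_sym by blast+
  \<comment> \<open>The edges of \<open>E\<close> between the two pairs form a perfect matching. The
    second matching becomes the first when \<open>y\<close> is negated, which exchanges
    \<open>c\<close> and \<open>d\<close>.\<close>
  then have "(E u c \<and> E d v \<and> F c v \<and> F u d) \<or> (E u d \<and> E c v \<and> F d v \<and> F u c)"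
    using mem d tot E_sym F_sym by blast
  then show False
  proof
    assume "E u c \<and> E d v \<and> F c v \<and> F u d"
    then interpret extremal_path V E F a b x y u c d v
      using uv cd Fuv Ecd F_sym by unfold_locales auto
    show False by (rule contradiction)
  next
    assume A: "E u d \<and> E c v \<and> F d v \<and> F u c"
    interpret N1: complementary_eigenfuns V F E b a "\<lambda>i. - y i" x by (rule S.uminus)
    interpret N: complementary_eigenfuns V E F a b x "\<lambda>i. - y i" by (rule N1.swap)
    interpret extremal_path V E F a b x "\<lambda>i. - y i" u d c v
      using A uv cd Fuv Ecd F_sym E_sym by unfold_locales auto
    show False by (rule contradiction)
  qed
qed

section \<open>Algebraic connectivity\<close>

text \<open>A product of linear factors determines the multiset of its roots, so only one sorted
  list can satisfy the description.\<close>

lemma sorted_eigenvalues_eq_sort: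
  fixes A :: "real mat"
  assumes "char_poly A = (\<Prod>x\<leftarrow>xs. [:- x, 1:])"
  shows "sorted_eigenvalues A = sort xs"
proof -
  have nz: "(\<Prod>x\<leftarrow>ys. [:- x, 1:]) \<noteq> 0" for ys :: "real list"
    by (induction ys) (auto simp del: mult_pCons_left)
  have roots: "proots (\<Prod>x\<leftarrow>ys. [:- x, 1:]) = mset ys" for ys :: "real list"
  proof (induction ys)
    case (Cons a ys)
    have "proots ([:- a, 1:] * (\<Prod>x\<leftarrow>ys. [:- x, 1:])) = proots [:- a, 1:] + proots (\<Prod>x\<leftarrow>ys. [:- x, 1:])"
      by (rule proots_mult) (use nz in auto)
    then show ?case using Cons.IH by (simp del: mult_pCons_left)
  qed simp
  have prod_sort: "(\<Prod>x\<leftarrow>sort xs. [:- x, 1:]) = (\<Prod>x\<leftarrow>xs. [:- x, 1:])"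
  proof -
    have "(\<Prod>x\<leftarrow>ys. [:- x, 1:]) = (\<Prod>x\<in>#mset ys. [:- x, 1:])" for ys :: "real list"
      by (induction ys) (auto simp del: mult_pCons_left)
    then show ?thesis by simp
  qed
  show ?thesis unfolding sorted_eigenvalues_def
  proof (rule the_equality)
    show "sorted (sort xs) \<and> char_poly A = (\<Prod>x\<leftarrow>sort xs. [:- x, 1:])"
      using assms prod_sort by simp
    fix ys assume "sorted ys \<and> char_poly A = (\<Prod>x\<leftarrow>ys. [:- x, 1:])"
    then have "sorted ys" "mset ys = mset xs" using assms roots[of ys] roots[of xs] by simp_all
    then show "ys = sort xs" by (intro properties_for_sort[symmetric]) auto
  qed
qed

lemma sort_nth_1_eq_Min:
  fixes xs :: "'a :: linorder list"
  assumes "xs \<noteq> []" "\<And>y. y \<in> set xs \<Longrightarrow> x \<le> y"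
  shows "sort (x # xs) ! 1 = Min (set xs)"
proof -
  obtain z zs where z: "sort xs = z # zs" using assms(1) by (metis list.exhaust mset_sort mset_zero_iff)
  have "sort (x # xs) = x # sort xs" using assms(2) by (simp add: insort_is_Cons)
  moreover have "sorted (z # zs)" "set (z # zs) = set xs" by (simp_all flip: z)
  then have "z = Min (set xs)" by (intro Min_eqI[symmetric]) auto
  ultimately show ?thesis by (simp add: z)
qed

lemma laplacian_mult:
  assumes "i < n" "\<not> E i i"
  shows "(\<Sum>j<n. laplacian n E $$ (i, j) * f j) = (\<Sum>j\<in>{0..<n}. if E i j then f i - f j else 0)"
proof -
  have "{k. k < n \<and> E i k} = {j \<in> {..<n}. E i j}" by auto
  then have deg: "real (degree n E i) = (\<Sum>j<n. if E i j then 1 else 0)"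
    by (simp add: degree_def sum.If_cases Collect_conj_eq Int_commute lessThan_def)
  have "(\<Sum>j<n. laplacian n E $$ (i, j) * f j)
      = (\<Sum>j<n. (if i = j then real (degree n E i) * f i else 0) - (if E i j then f j else 0))"
    using assms by (intro sum.cong) (auto simp: laplacian_def)
  also have "\<dots> = (\<Sum>j<n. if E i j then 1 else 0) * f i - (\<Sum>j<n. if E i j then f j else 0)"
    using assms by (simp add: sum_subtractf deg)
  also have "\<dots> = (\<Sum>j<n. if E i j then f i - f j else 0)"
    unfolding sum_distrib_right sum_subtractf[symmetric] by (intro sum.cong) auto
  finally show ?thesis by (simp add: lessThan_atLeast0)
qed

text \<open>Used in both directions: to read off eigenfunctions of one graph from \<open>P\<close>,
  and to see that the same \<open>P\<close> diagonalises the Laplacian of the complement.\<close>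

lemma orthogonal_diag_laplacian_iff:
  assumes P: "P \<in> carrier_mat n n" "P\<^sup>T * P = 1\<^sub>m n" and E: "\<And>i. i < n \<Longrightarrow> \<not> E i i"
  shows "orthogonal_diag n (laplacian n E) P d
    \<longleftrightarrow> (\<forall>k<n. lap_eigen {0..<n} E (d k) (\<lambda>i. P $$ (i, k)))"
proof -
  have L: "laplacian n E \<in> carrier_mat n n" by (simp add: laplacian_def)
  have "(laplacian n E * P) $$ (i, k) = (\<Sum>j\<in>{0..<n}. if E i j then P $$ (i, k) - P $$ (j, k) else 0)"
    if "i < n" "k < n" for i k
    using laplacian_mult[of i n E "\<lambda>j. P $$ (j, k)"] E that P L
    by (simp add: scalar_prod_def lessThan_atLeast0)
  moreover have "(P * mat_diag n d) $$ (i, k) = d k * P $$ (i, k)" if "i < n" "k < n" for i k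
    using that P by (simp add: mat_diag_mult_right)
  moreover have "laplacian n E * P = P * mat_diag n d \<longleftrightarrow>
      (\<forall>i<n. \<forall>k<n. (laplacian n E * P) $$ (i, k) = (P * mat_diag n d) $$ (i, k))"
    using L P by (auto intro!: eq_matI simp: carrier_matD[OF mat_diag_dim] simp del: index_mult_mat(1))
  ultimately show ?thesis using P by (auto simp: orthogonal_diag_def lap_eigen_def)
qed

text \<open>\<open>d 0 = 0\<close> is a smallest eigenvalue, so entry \<open>1\<close> of the sorted
  list is the least of the others, possibly \<open>0\<close> again.\<close>

lemma alg_conn_eq_Min:
  assumes n: "n \<ge> 2" and P: "orthogonal_diag n (laplacian n E) P d"
    and d: "d 0 = 0" "\<And>k. k < n \<Longrightarrow> 0 \<le> d k"
  shows "alg_conn n E = Min (d ` {1..<n})"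
proof -
  have "laplacian n E \<in> carrier_mat n n" by (simp add: laplacian_def)
  then have "sorted_eigenvalues (laplacian n E) = sort (map d [0..<n])"
    using char_poly_orthogonal_diag P by (intro sorted_eigenvalues_eq_sort) blast
  also have "map d [0..<n] = 0 # map d [1..<n]" using n d(1) by (simp add: upt_conv_Cons)
  finally have "alg_conn n E = sort (0 # map d [1..<n]) ! 1" by (simp add: alg_conn_def)
  also have "\<dots> = Min (set (map d [1..<n]))" using n d(2) by (intro sort_nth_1_eq_Min) auto
  finally show ?thesis by simp
qed

text \<open>Self-adjointness of the Laplacian.\<close>

lemma lap_inner_sym:
  assumes "\<And>i j. i \<in> V \<Longrightarrow> j \<in> V \<Longrightarrow> E i j \<longleftrightarrow> E j i"
  shows "(\<Sum>i\<in>V. f i * (\<Sum>j\<in>V. if E i j then g i - g j else 0))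
    = (\<Sum>i\<in>V. (\<Sum>j\<in>V. if E i j then f i - f j else 0) * (g i :: real))"
proof -
  have "(\<Sum>i\<in>V. f i * (\<Sum>j\<in>V. if E i j then g i - g j else 0))
      - (\<Sum>i\<in>V. (\<Sum>j\<in>V. if E i j then f i - f j else 0) * g i)
      = (\<Sum>i\<in>V. \<Sum>j\<in>V. if E i j then f j * g i else 0) - (\<Sum>i\<in>V. \<Sum>j\<in>V. if E i j then f i * g j else 0)"
    unfolding sum_distrib_left sum_distrib_right sum_subtractf[symmetric]
    by (intro sum.cong refl) (auto simp: algebra_simps)
  also have "(\<Sum>i\<in>V. \<Sum>j\<in>V. if E i j then f i * g j else 0) = (\<Sum>j\<in>V. \<Sum>i\<in>V. if E i j then f i * g j else 0)"
    by (rule sum.swap)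
  also have "\<dots> = (\<Sum>i\<in>V. \<Sum>j\<in>V. if E i j then f j * g i else 0)"
    using assms by (intro sum.cong refl) auto
  finally show ?thesis by simp
qed

text \<open>Expand \<open>z\<close> in the complete system \<open>v\<close> by Parseval; eigenvalues
  below \<open>a\<close> do no harm, since \<open>z\<close> has no component there.\<close>

lemma rayleigh_bound:
  fixes v :: "'k \<Rightarrow> 'a \<Rightarrow> real"
  assumes fin: "finite V" and sym: "\<And>i j. i \<in> V \<Longrightarrow> j \<in> V \<Longrightarrow> E i j \<longleftrightarrow> E j i"
    and complete: "\<And>i j. i \<in> V \<Longrightarrow> j \<in> V \<Longrightarrow> (\<Sum>k\<in>K. v k i * v k j) = (if i = j then 1 else 0)"
    and eig: "\<And>k. k \<in> K \<Longrightarrow> lap_eigen V E (d k) (v k)"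
    and le: "\<And>k. k \<in> K \<Longrightarrow> a \<le> d k \<or> (\<Sum>i\<in>V. v k i * z i) = 0"
  shows "2 * a * (\<Sum>i\<in>V. (z i)\<^sup>2) \<le> lap_energy V E z"
proof -
  let ?L = "\<lambda>f i. \<Sum>j\<in>V. if E i j then f i - f j else (0::real)"
  have parseval: "(\<Sum>i\<in>V. f i * g i) = (\<Sum>k\<in>K. (\<Sum>i\<in>V. v k i * f i) * (\<Sum>j\<in>V. v k j * g j))" for f g
  proof -
    have "(\<Sum>k\<in>K. (\<Sum>i\<in>V. v k i * f i) * (\<Sum>j\<in>V. v k j * g j))
        = (\<Sum>k\<in>K. \<Sum>i\<in>V. \<Sum>j\<in>V. f i * g j * (v k i * v k j))"
      unfolding sum_product by (intro sum.cong refl) (simp add: mult_ac)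
    also have "\<dots> = (\<Sum>i\<in>V. \<Sum>k\<in>K. \<Sum>j\<in>V. f i * g j * (v k i * v k j))" by (rule sum.swap)
    also have "\<dots> = (\<Sum>i\<in>V. \<Sum>j\<in>V. \<Sum>k\<in>K. f i * g j * (v k i * v k j))"
      by (intro sum.cong refl sum.swap)
    also have "\<dots> = (\<Sum>i\<in>V. \<Sum>j\<in>V. f i * g j * (if i = j then 1 else 0))"
      using complete by (simp flip: sum_distrib_left)
    also have "\<dots> = (\<Sum>i\<in>V. f i * g i)"
      using fin by (intro sum.cong refl) (simp add: if_distrib cong: if_cong)
    finally show ?thesis by simp
  qed
  have eigk: "(\<Sum>j\<in>V. v k j * ?L z j) = d k * (\<Sum>i\<in>V. v k i * z i)" if "k \<in> K" for k
  proof -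
    have "(\<Sum>j\<in>V. v k j * ?L z j) = (\<Sum>j\<in>V. ?L (v k) j * z j)" by (rule lap_inner_sym[OF sym])
    also have "\<dots> = (\<Sum>j\<in>V. d k * (v k j * z j))"
      using eig[OF that] unfolding lap_eigen_def by (intro sum.cong) auto
    finally show ?thesis by (simp add: sum_distrib_left)
  qed
  have "a * (\<Sum>i\<in>V. (z i)\<^sup>2) = (\<Sum>k\<in>K. a * (\<Sum>i\<in>V. v k i * z i)\<^sup>2)"
    using parseval[of z z] by (simp add: power2_eq_square sum_distrib_left)
  also have "\<dots> \<le> (\<Sum>k\<in>K. d k * (\<Sum>i\<in>V. v k i * z i)\<^sup>2)"
    using le by (intro sum_mono) (metis mult_right_mono mult_zero_right order_refl power_zero_numeral zero_le_power2)
  also have "\<dots> = (\<Sum>k\<in>K. (\<Sum>i\<in>V. v k i * z i) * (\<Sum>j\<in>V. v k j * ?L z j))"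
    using eigk by (intro sum.cong) (auto simp: power2_eq_square)
  also have "\<dots> = (\<Sum>i\<in>V. z i * ?L z i)" by (rule parseval[symmetric])
  finally show ?thesis using lap_energy_inner[of V E z, OF sym] by simp
qed

lemma lap_eigen_nonneg:
  assumes "\<And>i j. i \<in> V \<Longrightarrow> j \<in> V \<Longrightarrow> E i j \<longleftrightarrow> E j i" "lap_eigen V E a x" "(\<Sum>i\<in>V. (x i)\<^sup>2) = 1"
  shows "0 \<le> a"
proof -
  have "0 \<le> lap_energy V E x" unfolding lap_energy_def by (intro sum_nonneg) auto
  then show ?thesis using lap_energy_eigen[OF assms(1,2)] assms(3) by simp
qed

section \<open>Algebraic connectivity of a graph and its complement\<close>

locale complementary_graphs =
  fixes n :: nat and E F :: "nat \<Rightarrow> nat \<Rightarrow> bool"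
  assumes n: "n \<ge> 2"
    and E_sym: "\<And>i j. i < n \<Longrightarrow> j < n \<Longrightarrow> E i j \<longleftrightarrow> E j i"
    and E_irrefl: "\<And>i. i < n \<Longrightarrow> \<not> E i i"
    and F_iff: "\<And>i j. i < n \<Longrightarrow> j < n \<Longrightarrow> F i j \<longleftrightarrow> i \<noteq> j \<and> \<not> E i j"
begin

lemma swap: "complementary_graphs n F E"
  using n E_sym E_irrefl F_iff by unfold_locales auto

lemma F_sym: "i < n \<Longrightarrow> j < n \<Longrightarrow> F i j \<longleftrightarrow> F j i"
  using E_sym F_iff by blast

text \<open>The two Laplacians add up to \<open>n\<close> times the identity on functions of mean
  zero, and both annihilate constants, so one basis serves both graphs.\<close>

lemma eigenbasis:
  obtains v :: "nat \<Rightarrow> nat \<Rightarrow> real" and d :: "nat \<Rightarrow> real" where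
    "\<And>k l. k < n \<Longrightarrow> l < n \<Longrightarrow> (\<Sum>i\<in>{0..<n}. v k i * v l i) = (if k = l then 1 else 0)"
    "\<And>i j. i < n \<Longrightarrow> j < n \<Longrightarrow> (\<Sum>k\<in>{0..<n}. v k i * v k j) = (if i = j then 1 else 0)"
    "\<And>i. i < n \<Longrightarrow> v 0 i = 1 / sqrt n"
    "\<And>k. 0 < k \<Longrightarrow> k < n \<Longrightarrow> (\<Sum>i\<in>{0..<n}. v k i) = 0"
    "\<And>k. k < n \<Longrightarrow> lap_eigen {0..<n} E (d k) (v k)"
    "\<And>k. 0 < k \<Longrightarrow> k < n \<Longrightarrow> lap_eigen {0..<n} F (n - d k) (v k)"
    "alg_conn n E = Min (d ` {1..<n})"
    "alg_conn n F = Min ((\<lambda>k. n - d k) ` {1..<n})"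
proof -
  let ?L = "laplacian n E"
  define w where "w = vec n (\<lambda>_. 1 / sqrt n)"
  have L: "?L \<in> carrier_mat n n" by (simp add: laplacian_def)
  have LT: "?L\<^sup>T = ?L" using E_sym by (intro eq_matI) (auto simp: laplacian_def)
  have "(\<Sum>j<n. ?L $$ (i, j) * (1 / sqrt n)) = 0" if "i < n" for i
    using laplacian_mult[of i n E "\<lambda>_. 1 / sqrt n"] E_irrefl that by (simp cong: if_cong)
  then have "?L *\<^sub>v w = 0 \<cdot>\<^sub>v w"
    using L by (intro eq_vecI) (auto simp: w_def scalar_prod_def lessThan_atLeast0)
  moreover have "w \<bullet> w = 1" using n by (simp add: w_def scalar_prod_def)
  moreover have "w \<in> carrier_vec n" by (simp add: w_def)
  ultimately obtain P d where P: "orthogonal_diag n ?L P d" and P0: "col P 0 = w" "d 0 = 0"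
    using orthogonal_diag_with_eigenvector[OF L LT, of w 0] n by auto
  have Pc: "P \<in> carrier_mat n n" "P\<^sup>T * P = 1\<^sub>m n" using P by (auto simp: orthogonal_diag_def)
  define v where "v k i = P $$ (i, k)" for k i
  have eigE: "lap_eigen {0..<n} E (d k) (v k)" if "k < n" for k
    using P orthogonal_diag_laplacian_iff[OF Pc, of E d] E_irrefl that unfolding v_def by blast
  have orth: "(\<Sum>i\<in>{0..<n}. v k i * v l i) = (if k = l then 1 else 0)" if "k < n" "l < n" for k l
    using arg_cong[OF Pc(2), of "\<lambda>M. M $$ (k, l)"] that Pc(1) by (simp add: v_def scalar_prod_def)
  have compl: "(\<Sum>k\<in>{0..<n}. v k i * v k j) = (if i = j then 1 else 0)" if "i < n" "j < n" for i j
    using arg_cong[OF orthogonal_diag_inverse[OF P], of "\<lambda>M. M $$ (i, j)"] that Pc(1)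
    by (simp add: v_def scalar_prod_def)
  have v0: "v 0 i = 1 / sqrt n" if "i < n" for i
    using arg_cong[OF P0(1), of "\<lambda>u. u $ i"] that Pc(1) n by (simp add: v_def w_def)
  have sum0: "(\<Sum>i\<in>{0..<n}. v k i) = 0" if "0 < k" "k < n" for k
  proof -
    have "(\<Sum>i\<in>{0..<n}. v k i) / sqrt n = (\<Sum>i\<in>{0..<n}. v k i * v 0 i)"
      using v0 by (simp add: sum_divide_distrib)
    then show ?thesis using orth[of k 0] that n by simp
  qed
  \<comment> \<open>Index \<open>0\<close> is exceptional: constants have eigenvalue
    \<open>0\<close> in both graphs, not \<open>n - d 0\<close>.\<close>
  have eigF: "lap_eigen {0..<n} F (if k = 0 then 0 else n - d k) (v k)" if k: "k < n" for k
    unfolding lap_eigen_def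
  proof
    fix i assume i: "i \<in> {0..<n}"
    have "(\<Sum>j\<in>{0..<n}. if F i j then v k i - v k j else 0)
        = (\<Sum>j\<in>{0..<n}. (v k i - v k j) - (if E i j then v k i - v k j else 0))"
      using F_iff E_irrefl i by (intro sum.cong) auto
    also have "\<dots> = n * v k i - (\<Sum>j\<in>{0..<n}. v k j) - d k * v k i"
      using eigE[OF k] i by (simp add: sum_subtractf lap_eigen_def)
    also have "\<dots> = (if k = 0 then 0 else n - d k) * v k i"
      using sum0[of k] k v0 i P0(2) by (auto simp: algebra_simps)
    finally show "(\<Sum>j\<in>{0..<n}. if F i j then v k i - v k j else 0) = (if k = 0 then 0 else n - d k) * v k i" .
  qed
  have norm: "(\<Sum>i\<in>{0..<n}. (v k i)\<^sup>2) = 1" if "k < n" for k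
    using orth[OF that that] by (simp add: power2_eq_square)
  have "alg_conn n E = Min (d ` {1..<n})"
    using lap_eigen_nonneg[OF _ eigE norm] E_sym by (intro alg_conn_eq_Min[OF n P P0(2)]) auto
  moreover have "alg_conn n F = Min ((\<lambda>k. if k = 0 then 0 else n - d k) ` {1..<n})"
  proof (rule alg_conn_eq_Min[OF n])
    show "orthogonal_diag n (laplacian n F) P (\<lambda>k. if k = 0 then 0 else n - d k)"
      using orthogonal_diag_laplacian_iff[OF Pc, of F] F_iff eigF unfolding v_def by blast
    show "0 \<le> (if k = 0 then 0 else n - d k)" if "k < n" for k
      using lap_eigen_nonneg[OF _ eigF norm] F_sym that by auto
  qed simp
  moreover have "(\<lambda>k. if k = 0 then 0 else n - d k) ` {1..<n} = (\<lambda>k. n - d k) ` {1..<n}"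
    by (intro image_cong) auto
  ultimately have "alg_conn n E = Min (d ` {1..<n})" "alg_conn n F = Min ((\<lambda>k. n - d k) ` {1..<n})"
    by simp_all
  moreover have "lap_eigen {0..<n} F (n - d k) (v k)" if "0 < k" "k < n" for k
    using eigF[OF that(2)] that by simp
  ultimately show ?thesis using that[of v d] eigE orth compl v0 sum0 by blast
qed

lemma alg_conn_eigenfun:
  obtains x where "lap_eigen {0..<n} E (alg_conn n E) x" "(\<Sum>i\<in>{0..<n}. x i) = 0" "(\<Sum>i\<in>{0..<n}. (x i)\<^sup>2) = 1"
proof -
  obtain v and d :: "nat \<Rightarrow> real" where B: "\<And>k l. k < n \<Longrightarrow> l < n \<Longrightarrow> (\<Sum>i\<in>{0..<n}. v k i * v l i) = (if k = l then 1 else 0 :: real)"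
    "\<And>k. 0 < k \<Longrightarrow> k < n \<Longrightarrow> (\<Sum>i\<in>{0..<n}. v k i) = 0"
    "\<And>k. k < n \<Longrightarrow> lap_eigen {0..<n} E (d k) (v k)" "alg_conn n E = Min (d ` {1..<n})"
    by (rule eigenbasis) blast
  have "Min (d ` {1..<n}) \<in> d ` {1..<n}" using n by (intro Min_in) auto
  then obtain k where "k \<in> {1..<n}" "alg_conn n E = d k" using B(4) by auto
  then show ?thesis using that[of "v k"] B(1)[of k k] B(2,3)[of k] by (simp add: power2_eq_square)
qed

lemma alg_conn_nonneg: "0 \<le> alg_conn n E"
proof -
  obtain x where "lap_eigen {0..<n} E (alg_conn n E) x" "(\<Sum>i\<in>{0..<n}. (x i)\<^sup>2) = 1"
    by (rule alg_conn_eigenfun)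
  then show ?thesis using lap_eigen_nonneg[of "{0..<n}" E] E_sym by auto
qed

text \<open>\<open>z\<close> is orthogonal to the constant \<open>v 0\<close>, and all other
  \<open>d k\<close> are at least \<open>alg_conn n E\<close>, so \<open>rayleigh_bound\<close>
  applies.\<close>

lemma alg_conn_le:
  assumes z: "lap_eigen {0..<n} E e z" "(\<Sum>i\<in>{0..<n}. z i) = 0" and ne: "i0 < n" "z i0 \<noteq> 0"
  shows "alg_conn n E \<le> e"
proof -
  obtain v and d :: "nat \<Rightarrow> real" where B: "\<And>i j. i < n \<Longrightarrow> j < n \<Longrightarrow> (\<Sum>k\<in>{0..<n}. v k i * v k j) = (if i = j then 1 else 0 :: real)"
    "\<And>i. i < n \<Longrightarrow> v 0 i = 1 / sqrt n"
    "\<And>k. k < n \<Longrightarrow> lap_eigen {0..<n} E (d k) (v k)" "alg_conn n E = Min (d ` {1..<n})"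
    by (rule eigenbasis) blast
  have "2 * alg_conn n E * (\<Sum>i\<in>{0..<n}. (z i)\<^sup>2) \<le> lap_energy {0..<n} E z"
  proof (rule rayleigh_bound[where K = "{0..<n}" and v = v and d = d])
    fix k assume k: "k \<in> {0..<n}"
    show "alg_conn n E \<le> d k \<or> (\<Sum>i\<in>{0..<n}. v k i * z i) = 0"
    proof (cases "k = 0")
      case True
      then show ?thesis using B(2) z(2) by (simp flip: sum_divide_distrib)
    next
      case False
      then show ?thesis using k B(4) by simp
    qed
  qed (use E_sym B in auto)
  also have "\<dots> = 2 * e * (\<Sum>i\<in>{0..<n}. (z i)\<^sup>2)"
    using E_sym by (intro lap_energy_eigen[OF _ z(1)]) auto
  finally have "alg_conn n E * (\<Sum>i\<in>{0..<n}. (z i)\<^sup>2) \<le> e * (\<Sum>i\<in>{0..<n}. (z i)\<^sup>2)" by simp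
  moreover have "(\<Sum>i\<in>{0..<n}. (z i)\<^sup>2) > 0" using ne by (intro sum_pos2[of _ i0]) auto
  ultimately show ?thesis by simp
qed

text \<open>As both values are nonnegative, otherwise both would be below \<open>1\<close>;
  orthogonal eigenfunctions for them then meet the contradictory assumptions of
  \<open>complementary_eigenfuns\<close>.\<close>

lemma alg_conn_sum_le_one:
  assumes le: "alg_conn n E + alg_conn n F \<le> 1"
  shows "alg_conn n E = 1 \<and> alg_conn n F = 0 \<or> alg_conn n E = 0 \<and> alg_conn n F = 1"
proof (rule ccontr)
  interpret S: complementary_graphs n F E by (rule swap)
  assume "\<not> ?thesis"
  then have lt: "alg_conn n E < 1" "alg_conn n F < 1"
    using le alg_conn_nonneg S.alg_conn_nonneg by auto
  obtain v and d :: "nat \<Rightarrow> real" where B: "\<And>k l. k < n \<Longrightarrow> l < n \<Longrightarrow> (\<Sum>i\<in>{0..<n}. v k i * v l i) = (if k = l then 1 else 0 :: real)"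
    "\<And>k. 0 < k \<Longrightarrow> k < n \<Longrightarrow> (\<Sum>i\<in>{0..<n}. v k i) = 0"
    "\<And>k. k < n \<Longrightarrow> lap_eigen {0..<n} E (d k) (v k)"
    "\<And>k. 0 < k \<Longrightarrow> k < n \<Longrightarrow> lap_eigen {0..<n} F (n - d k) (v k)"
    "alg_conn n E = Min (d ` {1..<n})" "alg_conn n F = Min ((\<lambda>k. n - d k) ` {1..<n})"
    by (rule eigenbasis) blast
  let ?I = "{1..<n}"
  have "Min (d ` ?I) \<in> d ` ?I" using n by (intro Min_in) auto
  then obtain k where k: "k \<in> ?I" "alg_conn n E = d k" using B(5) by auto
  have "Min ((\<lambda>k. n - d k) ` ?I) \<in> (\<lambda>k. n - d k) ` ?I" using n by (intro Min_in) auto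
  then obtain l where l: "l \<in> ?I" "alg_conn n F = n - d l" using B(6) by auto
  \<comment> \<open>Orthogonality requires distinct indices. If \<open>l = k\<close>, then
    \<open>d k\<close> is both minimal and maximal, so any other index serves; one exists because
    for \<open>n = 2\<close> the sum would be \<open>2\<close>.\<close>
  have "\<exists>l\<in>?I. l \<noteq> k \<and> alg_conn n F = n - d l"
  proof (cases "l = k")
    case True
    have "n \<noteq> 2" using True k l le by auto
    define l' :: nat where "l' = (if k = 1 then 2 else 1)"
    have l': "l' \<in> ?I" "l' \<noteq> k" using n \<open>n \<noteq> 2\<close> by (auto simp: l'_def)
    have "d k \<le> d l'" using l' B(5) k by simp
    moreover have "alg_conn n F \<le> n - d l'" using l' B(6) by simp
    ultimately show ?thesis using l l' True by auto
  qed (use l in auto)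
  then obtain l where l: "l \<in> ?I" "l \<noteq> k" "alg_conn n F = n - d l" by blast
  have kl: "0 < k" "k < n" "0 < l" "l < n" using k l by auto
  have norm: "(\<Sum>i\<in>{0..<n}. (v k i)\<^sup>2) = 1" "(\<Sum>i\<in>{0..<n}. (v l i)\<^sup>2) = 1"
    "(\<Sum>i\<in>{0..<n}. v k i * v l i) = 0"
    using B(1) kl l(2) by (auto simp: power2_eq_square)
  have eig: "lap_eigen {0..<n} E (alg_conn n E) (v k)" "lap_eigen {0..<n} F (alg_conn n F) (v l)"
    using B(3,4) kl k(2) l(3) by auto
  interpret complementary_eigenfuns "{0..<n}" E F "alg_conn n E" "alg_conn n F" "v k" "v l"
  proof
    show "i \<in> {0..<n} \<Longrightarrow> j \<in> {0..<n} \<Longrightarrow> E i j \<longleftrightarrow> E j i" for i j using E_sym by auto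
    show "i \<in> {0..<n} \<Longrightarrow> j \<in> {0..<n} \<Longrightarrow> F i j \<longleftrightarrow> i \<noteq> j \<and> \<not> E i j" for i j
      using F_iff by auto
  qed (use E_irrefl eig norm lt le B(2) kl in auto)
  show False by (rule contradiction)
qed

text \<open>The level sets of a null function of \<open>F\<close> are completely joined in \<open>E\<close>.  If both a level set
  and its complement had two vertices, then the extremal vertices of \<open>x\<close> would be adjacent or have
  two common neighbours, forcing an eigenvalue of at least 2.\<close>

lemma dominating_vertex_of_equality:
  assumes a: "alg_conn n E = 1" and b: "alg_conn n F = 0"
  obtains c where "c < n" "\<And>i. i < n \<Longrightarrow> i \<noteq> c \<Longrightarrow> E c i" "\<not> connected_graph ({0..<n} - {c}, E)"
proof -
  interpret S: complementary_graphs n F E by (rule swap)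
  let ?V = "{0..<n}"
  obtain x where x: "lap_eigen ?V E 1 x" "(\<Sum>i\<in>?V. x i) = 0" "(\<Sum>i\<in>?V. (x i)\<^sup>2) = 1"
    using alg_conn_eigenfun unfolding a by blast
  obtain y where y: "lap_eigen ?V F 0 y" "(\<Sum>i\<in>?V. y i) = 0" "(\<Sum>i\<in>?V. (y i)\<^sup>2) = 1"
    using S.alg_conn_eigenfun unfolding b by blast
  have ext: "\<exists>u\<in>?V. \<exists>v\<in>?V. (\<forall>i\<in>?V. f i \<le> f u) \<and> (\<forall>i\<in>?V. f v \<le> f i) \<and> f v < 0 \<and> 0 < f u"
    if f: "(\<Sum>i\<in>?V. f i) = 0" "(\<Sum>i\<in>?V. (f i)\<^sup>2) = 1" for f :: "nat \<Rightarrow> real"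
  proof -
    have ne: "?V \<noteq> {}" using n by auto
    have "Max (f ` ?V) \<in> f ` ?V" "Min (f ` ?V) \<in> f ` ?V"
      using ne by (intro Max_in Min_in; simp)+
    then obtain u v where uv: "u \<in> ?V" "f u = Max (f ` ?V)" "v \<in> ?V" "f v = Min (f ` ?V)" by auto
    have max: "f i \<le> f u" and min: "f v \<le> f i" if "i \<in> ?V" for i using uv that by auto
    obtain k where k: "k \<in> ?V" "f k \<noteq> 0" using f(2) by (metis (no_types, lifting) power_zero_numeral sum.neutral zero_neq_one)
    have "f v < 0"
    proof (rule ccontr)
      assume "\<not> f v < 0"
      then have "\<forall>i\<in>?V. 0 \<le> f i" using min by force
      then have "\<forall>i\<in>?V. f i = 0" using f(1) by (subst (asm) sum_nonneg_eq_0_iff) auto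
      then show False using k by blast
    qed
    moreover have "0 < f u"
    proof (rule ccontr)
      assume "\<not> 0 < f u"
      then have "\<forall>i\<in>?V. 0 \<le> - f i" using max by force
      moreover have "(\<Sum>i\<in>?V. - f i) = 0" using f(1) by (simp add: sum_negf)
      ultimately have "\<forall>i\<in>?V. - f i = 0" by (subst (asm) sum_nonneg_eq_0_iff) auto
      then show False using k by auto
    qed
    ultimately show ?thesis using uv(1,3) max min by blast
  qed
  obtain u v where uv: "u \<in> ?V" "v \<in> ?V" "\<And>i. i \<in> ?V \<Longrightarrow> x i \<le> x u" "\<And>i. i \<in> ?V \<Longrightarrow> x v \<le> x i" "x v < 0" "0 < x u"
    using ext[OF x(2,3)] by blast
  obtain p q where pq: "p \<in> ?V" "q \<in> ?V" "y q < 0" "0 < y p"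
    using ext[OF y(2,3)] by blast
  have energy: "lap_energy ?V F y = 0"
    using lap_energy_eigen[OF _ y(1)] F_sym by simp
  \<comment> \<open>Zero energy makes \<open>y\<close> constant along the edges of
    \<open>F\<close>.\<close>
  have Fy: "y i = y j" if "i \<in> ?V" "j \<in> ?V" "F i j" for i j
  proof -
    have "2 * (\<Sum>(i, j)\<in>{(i, j)}. (y i - y j)\<^sup>2) \<le> lap_energy ?V F y"
      using that F_sym F_iff by (intro lap_energy_ge_edges) auto
    then show ?thesis using energy by simp
  qed
  define S where "S = {i \<in> ?V. y i = y p}"
  have SE: "E i j" "E j i" if "i \<in> S" "j \<in> ?V - S" for i j
    using that Fy[of i j] F_iff[of i j] E_sym[of i j] by (auto simp: S_def)
  have pS: "p \<in> S" "q \<in> ?V - S" using pq by (auto simp: S_def)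
  have bound: "(\<Sum>j\<in>T. (if E u j then x u - x j else 0) + (if E v j then x j - x v else 0)) \<le> x u - x v"
    if "T \<subseteq> ?V" for T
    using eigen_extremes[OF _ x(1) uv(1-4) that] by simp
  have "S = {p} \<or> ?V - S = {q}"
  proof (rule ccontr)
    assume "\<not> (S = {p} \<or> ?V - S = {q})"
    then obtain p' q' where p'q': "p' \<in> S" "p' \<noteq> p" "q' \<in> ?V - S" "q' \<noteq> q" using pS by blast
    have pV: "p \<in> ?V" "p' \<in> ?V" "q \<in> ?V" "q' \<in> ?V" using p'q' pS by (auto simp: S_def)
    consider "E u v" "E v u" | "E u p" "E v p" "E u p'" "E v p'" | "E u q" "E v q" "E u q'" "E v q'"
      using SE uv(1,2) p'q' pS by (cases "u \<in> S"; cases "v \<in> S") blast+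
    then show False
    proof cases
      case 1
      then have "u \<noteq> v" using E_irrefl uv(1) by auto
      then show False using bound[of "{u, v}"] uv 1 E_irrefl by auto
    next
      case 2
      then show False using bound[of "{p, p'}"] uv p'q' pV by auto
    next
      case 3
      then show False using bound[of "{q, q'}"] uv p'q' pV by auto
    qed
  qed
  then obtain c where c: "c \<in> ?V" "\<And>i. i \<in> ?V \<Longrightarrow> i \<noteq> c \<Longrightarrow> E c i"
  proof
    assume "S = {p}"
    then show ?thesis using that[of p] SE pq by auto
  next
    assume "?V - S = {q}"
    then show ?thesis using that[of q] SE pq by blast
  qed
  \<comment> \<open>As \<open>c\<close> is joined to all vertices and \<open>x\<close> has mean
    zero, the equation at \<open>c\<close> reads \<open>n * x c = x c\<close>.\<close>
  have xc: "x c = 0"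
  proof -
    have "(\<Sum>j\<in>?V. if E c j then x c - x j else 0) = (\<Sum>j\<in>?V. x c - x j)"
      using c by (intro sum.cong) auto
    then have "n * x c = x c" using x(1,2) c(1) by (simp add: lap_eigen_def sum_subtractf)
    then show ?thesis using n by auto
  qed
  have uc: "u \<noteq> c" using xc uv(6) by auto
  \<comment> \<open>At a vertex where \<open>x\<close> is maximal, the edge to \<open>c\<close>
    already contributes \<open>x i - 0\<close>, the full right-hand side. Hence no other neighbour
    can have a smaller value.\<close>
  have nbr: "x j = x u" if "i \<in> ?V" "x i = x u" "j \<in> ?V" "j \<noteq> c" "E i j" for i j
  proof -
    have ic: "i \<noteq> c" using that xc uv(6) by auto
    then have Eic: "E i c" using c that(1) E_sym by auto
    have "(\<Sum>k\<in>{c, j}. if E i k then x i - x k else 0) \<le> (\<Sum>k\<in>?V. if E i k then x i - x k else 0)"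
      using that c(1) uv(3) by (intro sum_mono2) auto
    also have "\<dots> = x i" using x(1) that(1) by (simp add: lap_eigen_def)
    finally have "x u \<le> x j" using that Eic xc by auto
    then show ?thesis using uv(3)[OF that(3)] by simp
  qed
  \<comment> \<open>Connectedness without \<open>c\<close> would spread the positive maximum to
    \<open>v\<close>, where \<open>x\<close> is negative.\<close>
  have "\<not> connected_graph (?V - {c}, E)"
  proof
    assume conn: "connected_graph (?V - {c}, E)"
    have "x i = x u" if "i \<in> ?V - {c}" for i
    proof -
      have "(\<lambda>a b. a \<in> ?V - {c} \<and> b \<in> ?V - {c} \<and> E a b)\<^sup>*\<^sup>* u i"
        using conn that uv(1) uc by (auto simp: connected_graph_def)
      then show ?thesis by (induction rule: rtranclp_induct) (use nbr in auto)
    qed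
    then have "x v = x u" if "v \<noteq> c" using uv(2) that by auto
    then show False using xc uv(5,6) by fastforce
  qed
  then show ?thesis using that[of c] c by auto
qed

text \<open>Explicit eigenfunctions suffice: one of \<open>E\<close> for the eigenvalue
  \<open>1\<close>, opposite in sign on the two sides of a separation, and one of \<open>F\<close>
  for \<open>0\<close>, since \<open>c\<close> is isolated in \<open>F\<close>.\<close>

lemma alg_conn_sum_of_dominating_vertex:
  assumes c: "c < n" "\<And>i. i < n \<Longrightarrow> i \<noteq> c \<Longrightarrow> E c i"
    and nconn: "\<not> connected_graph ({0..<n} - {c}, E)"
  shows "alg_conn n E + alg_conn n F \<le> 1"
proof -
  interpret S: complementary_graphs n F E by (rule swap)
  let ?V = "{0..<n}"
  have Eic: "E i c" if "i < n" "i \<noteq> c" for i using c that E_sym by blast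
  \<comment> \<open>The empty graph fails \<open>connected_graph\<close> too; nonemptiness is what
    yields an unreachable pair.\<close>
  have "?V - {c} \<noteq> {}"
  proof -
    have "(if c = 0 then 1 else 0) \<in> ?V - {c}" using n by auto
    then show ?thesis by blast
  qed
  with nconn obtain h h' where h: "h \<in> ?V - {c}" "h' \<in> ?V - {c}"
    and nr: "\<not> (\<lambda>a b. a \<in> ?V - {c} \<and> b \<in> ?V - {c} \<and> E a b)\<^sup>*\<^sup>* h h'" (is "\<not> ?R h h'")
    unfolding connected_graph_def fst_conv snd_conv by blast
  define P where "P = {i \<in> ?V - {c}. ?R h i}"
  define Q where "Q = ?V - {c} - P"
  have hP: "h \<in> P" "h' \<in> Q" using h nr by (auto simp: P_def Q_def)
  have PV: "P \<subseteq> ?V" "Q \<subseteq> ?V" "P \<inter> Q = {}" "c \<notin> P" "c \<notin> Q" "?V = insert c (P \<union> Q)"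
    using c(1) by (auto simp: P_def Q_def)
  have finPQ: "finite P" "finite Q" using PV by (auto intro: finite_subset)
  have PQ: "\<not> E i j" "\<not> E j i" if "i \<in> P" "j \<in> Q" for i j
  proof -
    show "\<not> E i j"
    proof
      assume "E i j"
      moreover have "?R h i" "i \<in> ?V - {c}" "j \<in> ?V - {c}" using that by (auto simp: P_def Q_def)
      ultimately have "?R h j" by (intro rtranclp.rtrancl_into_rtrancl[of _ h i j]) auto
      then show False using that by (auto simp: P_def Q_def)
    qed
    moreover have "i \<in> ?V" "j \<in> ?V" using that PV(1,2) by blast+
    ultimately show "\<not> E j i" using E_sym[of i j] by auto
  qed
  \<comment> \<open>Weighted by the sizes of the opposite sides, to have mean zero. Off
    \<open>c\<close>, only the edge to \<open>c\<close>, where \<open>z\<close> is \<open>0\<close>,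
    contributes.\<close>
  define z where "z i = (if i = c then 0 else if i \<in> P then real (card Q) else - real (card P))" for i
  have sz: "(\<Sum>i\<in>?V. z i) = 0"
  proof -
    have "(\<Sum>i\<in>?V. z i) = z c + (\<Sum>i\<in>P \<union> Q. z i)"
      unfolding PV(6) using PV(4,5) finPQ by (intro sum.insert) auto
    also have "(\<Sum>i\<in>P \<union> Q. z i) = (\<Sum>i\<in>P. z i) + (\<Sum>i\<in>Q. z i)"
      using PV(3) finPQ by (intro sum.union_disjoint) auto
    also have "(\<Sum>i\<in>P. z i) = (\<Sum>i\<in>P. real (card Q))" using PV(4) by (intro sum.cong) (auto simp: z_def)
    also have "(\<Sum>i\<in>Q. z i) = (\<Sum>i\<in>Q. - real (card P))" using PV(3,5) by (intro sum.cong) (auto simp: z_def)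
    finally show ?thesis by (simp add: z_def)
  qed
  have zeig: "lap_eigen ?V E 1 z"
    unfolding lap_eigen_def
  proof
    fix i assume i: "i \<in> ?V"
    show "(\<Sum>j\<in>?V. if E i j then z i - z j else 0) = 1 * z i"
    proof (cases "i = c")
      case True
      have "(\<Sum>j\<in>?V. if E i j then z i - z j else 0) = (\<Sum>j\<in>?V. - z j)"
        using True c by (intro sum.cong) (auto simp: z_def)
      then show ?thesis using sz True by (simp add: sum_negf z_def)
    next
      case False
      have "(\<Sum>j\<in>?V. if E i j then z i - z j else 0) = (\<Sum>j\<in>?V. if j = c then z i else 0)"
      proof (rule sum.cong[OF refl])
        fix j assume j: "j \<in> ?V"
        show "(if E i j then z i - z j else 0) = (if j = c then z i else 0)"
        proof (cases "j = c")
          case True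
          then show ?thesis using Eic[of i] False i by (simp add: z_def)
        next
          case jc: False
          have "i \<in> P \<union> Q" "j \<in> P \<union> Q" using i j False jc PV(6) by auto
          then have "E i j \<Longrightarrow> z i = z j" using PQ[of i j] PQ[of j i] False jc PV(3) by (auto simp: z_def)
          then show ?thesis using jc by simp
        qed
      qed
      then show ?thesis using c(1) by simp
    qed
  qed
  have "card Q \<noteq> 0" using hP finPQ by auto
  then have "z h \<noteq> 0" using hP PV(4) by (auto simp: z_def)
  then have 1: "alg_conn n E \<le> 1" using alg_conn_le[OF zeig sz, of h] h by auto
  \<comment> \<open>The indicator of \<open>c\<close>, scaled by \<open>n\<close> and shifted to
    mean zero.\<close>
  define t where "t i = (if i = c then real n - 1 else - 1)" for i
  have "(\<Sum>i\<in>?V. t i) = (\<Sum>i\<in>?V. (if i = c then real n else 0) - 1)"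
    by (intro sum.cong) (auto simp: t_def)
  then have st: "(\<Sum>i\<in>?V. t i) = 0" using c(1) by (simp add: sum_subtractf)
  have Ft: "F i j \<Longrightarrow> t i = t j" if "i < n" "j < n" for i j
    using that F_iff[of i j] c(2)[of j] Eic[of i] by (auto simp: t_def)
  have "(\<Sum>j\<in>?V. if F i j then t i - t j else 0) = 0" if "i < n" for i
  proof (rule sum.neutral, rule ballI)
    fix j assume "j \<in> ?V"
    then show "(if F i j then t i - t j else 0) = 0" using Ft[of i j] that by simp
  qed
  then have "lap_eigen ?V F 0 t" by (simp add: lap_eigen_def)
  moreover have "t c \<noteq> 0" using n by (simp add: t_def)
  ultimately have "alg_conn n F \<le> 0" using S.alg_conn_le[OF _ st c(1)] by blast
  then show ?thesis using 1 by simp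
qed

end

section \<open>Joins with a single vertex\<close>

lemma join_of_dominating_vertex:
  fixes E :: "nat \<Rightarrow> nat \<Rightarrow> bool"
  assumes sym: "\<And>i j. i < n \<Longrightarrow> j < n \<Longrightarrow> E i j \<longleftrightarrow> E j i" and irrefl: "\<And>i. i < n \<Longrightarrow> \<not> E i i"
    and c: "c < n" "\<And>i. i < n \<Longrightarrow> i \<noteq> c \<Longrightarrow> E c i" and nconn: "\<not> connected_graph ({0..<n} - {c}, E)"
  shows "\<exists>H :: nat graph. simple_graph H \<and> card (fst H) = n - 1 \<and> \<not> connected_graph H
      \<and> graph_iso ({0..<n}, E) (graph_join K1 H)"
proof (intro exI conjI)
  let ?H = "({0..<n} - {c}, E)"
  show "simple_graph ?H" using sym irrefl by (auto simp: simple_graph_def)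
  show "card (fst ?H) = n - 1" using c(1) by simp
  show "\<not> connected_graph ?H" by (rule nconn)
  let ?f = "\<lambda>i. if i = c then Inl () else Inr i"
  have "bij_betw ?f {0..<n} (fst (graph_join K1 ?H))"
    using c(1) by (auto simp: bij_betw_def inj_on_def graph_join_def K1_def image_iff)
  moreover have "E i j \<longleftrightarrow> snd (graph_join K1 ?H) (?f i) (?f j)" if "i < n" "j < n" for i j
    using that c irrefl sym by (auto simp: graph_join_def K1_def)
  ultimately show "graph_iso ({0..<n}, E) (graph_join K1 ?H)"
    unfolding graph_iso_def by (intro exI[of _ ?f]) auto
qed

text \<open>\<open>c\<close> is the preimage of the single vertex. The isomorphism carries walks
  avoiding \<open>c\<close> to walks in \<open>H\<close>, so connectedness without \<open>c\<close>
  would make \<open>H\<close> connected.\<close>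

lemma dominating_vertex_of_join:
  fixes E :: "nat \<Rightarrow> nat \<Rightarrow> bool" and H :: "'w graph"
  assumes H: "\<not> connected_graph H" and iso: "graph_iso ({0..<n}, E) (graph_join K1 H)"
  obtains c where "c < n" "\<And>i. i < n \<Longrightarrow> i \<noteq> c \<Longrightarrow> E c i" "\<not> connected_graph ({0..<n} - {c}, E)"
proof -
  let ?V = "{0..<n}"
  obtain f where f: "bij_betw f ?V (Inl ` {()} \<union> Inr ` fst H)"
    and adj: "\<And>i j. i \<in> ?V \<Longrightarrow> j \<in> ?V \<Longrightarrow> E i j \<longleftrightarrow> snd (graph_join K1 H) (f i) (f j)"
    using iso by (auto simp: graph_iso_def graph_join_def K1_def)
  have "Inl () \<in> f ` ?V" using f by (auto simp: bij_betw_def)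
  then obtain c where c: "c \<in> ?V" "f c = Inl ()" by auto
  have inr: "\<exists>h\<in>fst H. f i = Inr h" if "i \<in> ?V" "i \<noteq> c" for i
  proof -
    have "f i \<noteq> Inl ()" using f c that by (auto simp: bij_betw_def inj_on_def)
    moreover have "f i \<in> Inl ` {()} \<union> Inr ` fst H" using f that by (auto simp: bij_betw_def)
    ultimately show ?thesis by auto
  qed
  have dom: "E c i" if "i < n" "i \<noteq> c" for i
    using inr[of i] adj[of c i] c that by (auto simp: graph_join_def)
  have "connected_graph H" if conn: "connected_graph (?V - {c}, E)"
    unfolding connected_graph_def
  proof (intro conjI ballI)
    have "?V - {c} \<noteq> {}" using conn unfolding connected_graph_def fst_conv by blast
    then obtain i where "i \<in> ?V - {c}" by blast
    then show "fst H \<noteq> {}" using inr by blast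
    let ?R = "\<lambda>a b. a \<in> fst H \<and> b \<in> fst H \<and> snd H a b"
    fix h h' assume h: "h \<in> fst H" "h' \<in> fst H"
    have pre: "\<exists>i\<in>?V - {c}. f i = Inr g" if "g \<in> fst H" for g
    proof -
      have "Inr g \<in> f ` ?V" using f that by (auto simp: bij_betw_def)
      then show ?thesis using c(2) by force
    qed
    obtain i i' where i: "i \<in> ?V - {c}" "f i = Inr h" "i' \<in> ?V - {c}" "f i' = Inr h'"
      using pre h by metis
    have "(\<lambda>a b. a \<in> ?V - {c} \<and> b \<in> ?V - {c} \<and> E a b)\<^sup>*\<^sup>* i i'"
      using conn i by (auto simp: connected_graph_def)
    then have "\<forall>g'. f i' = Inr g' \<longrightarrow> ?R\<^sup>*\<^sup>* h g'"
    proof (induction rule: rtranclp_induct)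
      case base
      then show ?case using i(2) by auto
    next
      case (step j k)
      obtain g where g: "g \<in> fst H" "f j = Inr g" using inr[of j] step.hyps by auto
      have "?R\<^sup>*\<^sup>* h g" using step.IH g by auto
      moreover have "?R g g'" if "f k = Inr g'" for g'
        using step.hyps adj[of j k] g that inr[of k] by (auto simp: graph_join_def)
      ultimately show ?case by (blast intro: rtranclp.rtrancl_into_rtrancl[of ?R h g])
    qed
    then show "?R\<^sup>*\<^sup>* h h'" using i by auto
  qed
  then show ?thesis using that[of c] c dom H by auto
qed

theorem theorem1:
  fixes n :: nat and E :: "nat \<Rightarrow> nat \<Rightarrow> bool"
  assumes "n \<ge> 2"
    and "simple_graph ({0..<n}, E)"
  shows "alg_conn n E + alg_conn n (complement n E) \<ge> 1 \<and>
    (alg_conn n E + alg_conn n (complement n E) = 1 \<longleftrightarrow>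
      (\<exists>H :: nat graph. simple_graph H \<and> card (fst H) = n - 1 \<and>
         \<not> connected_graph H \<and>
         (graph_iso ({0..<n}, E) (graph_join K1 H) \<or>
          graph_iso ({0..<n}, complement n E) (graph_join K1 H))))"
proof -
  let ?F = "complement n E"
  interpret G: complementary_graphs n E ?F
    using assms by unfold_locales (auto simp: simple_graph_def complement_def)
  interpret C: complementary_graphs n ?F E by (rule G.swap)
  let ?s = "alg_conn n E + alg_conn n ?F"
  \<comment> \<open>A sum below \<open>1\<close> would fall under
    \<open>alg_conn_sum_le_one\<close>, whose two alternatives both have sum
    \<open>1\<close>.\<close>
  have ge: "?s \<ge> 1" using G.alg_conn_sum_le_one by linarith
  have "\<exists>H :: nat graph. simple_graph H \<and> card (fst H) = n - 1 \<and> \<not> connected_graph H \<and>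
      (graph_iso ({0..<n}, E) (graph_join K1 H) \<or> graph_iso ({0..<n}, ?F) (graph_join K1 H))" if eq: "?s = 1"
  proof -
    consider "alg_conn n E = 1" "alg_conn n ?F = 0" | "alg_conn n ?F = 1" "alg_conn n E = 0"
      using G.alg_conn_sum_le_one eq by auto
    then show ?thesis
    proof cases
      case 1
      obtain c where "c < n" "\<And>i. i < n \<Longrightarrow> i \<noteq> c \<Longrightarrow> E c i" "\<not> connected_graph ({0..<n} - {c}, E)"
        using G.dominating_vertex_of_equality[OF 1] by blast
      then show ?thesis using join_of_dominating_vertex[of n E c] G.E_sym G.E_irrefl by blast
    next
      case 2
      obtain c where "c < n" "\<And>i. i < n \<Longrightarrow> i \<noteq> c \<Longrightarrow> ?F c i" "\<not> connected_graph ({0..<n} - {c}, ?F)"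
        using C.dominating_vertex_of_equality[OF 2] by blast
      then show ?thesis using join_of_dominating_vertex[of n ?F c] C.E_sym C.E_irrefl by blast
    qed
  qed
  moreover have "?s = 1" if H: "\<not> connected_graph H"
    "graph_iso ({0..<n}, E) (graph_join K1 H) \<or> graph_iso ({0..<n}, ?F) (graph_join K1 H)" for H :: "nat graph"
  proof -
    from H(2) have "?s \<le> 1"
    proof
      assume "graph_iso ({0..<n}, E) (graph_join K1 H)"
      from dominating_vertex_of_join[OF H(1) this] G.alg_conn_sum_of_dominating_vertex
      show ?thesis by metis
    next
      assume "graph_iso ({0..<n}, ?F) (graph_join K1 H)"
      from dominating_vertex_of_join[OF H(1) this] C.alg_conn_sum_of_dominating_vertex
      show ?thesis by (metis add.commute)
    qed
    then show ?thesis using ge by simp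
  qed
  ultimately show ?thesis using ge by blast
qed

end
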